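(* Let $x_0,x_1,\dots$ be generated by the algorithm dist-EF-SGD (described in the context) with $M$ workers, a $\delta$-compressor $\mathcal C$ with $\delta\in(0,1)$, $T$ iterations, and learning rates $\{\eta_t\}$ with $\eta_{-1}=0$. Suppose that Assumptions 1, 2 and 3 (stated in the context) hold, and that $0<\eta_t<\frac{3}{2L}$ for all $t\ge 0$. Then \begin{align*} \mathbf E[\lVert\nabla f(x_o)\rVert^2]\le{}& \frac{4(f(x_0)-f^\star)}{\sum_{k=0}^{T-1}\eta_k(3-2L\eta_k)}+\frac{2L\sigma^2}{M}\sum_{t=0}^{T-1}\frac{\eta_t^2}{\sum_{k=0}^{T-1}\eta_k(3-2L\eta_k)}\\ &+\frac{8(1-\delta)(2-\delta)G^2L^2}{\delta\sum_{k=0}^{T-1}\eta_k(3-2L\eta_k)}\sum_{t=0}^{T-1}\eta_t\eta_{t-1}^2\sum_{k=0}^{t-1}\frac{\eta_{t-1-k}^2}{\eta_{t-1}^2}\alpha^k\\ &+\frac{16(1-\delta)(2-\delta)^3G^2L^2}{\delta^2\sum_{k=0}^{T-1}\eta_k(3-2L\eta_k)}\sum_{t=0}^{T-1}\eta_t\eta_{t-1}^2\sum_{j=0}^{t-1}\alpha^{t-1-j}\sum_{k=0}^{j}\frac{\eta_{j-k}^2}{\eta_{t-1}^2}\alpha^k , \end{align*} where $\alpha=1-\frac{\delta}{2}$, $G^2=\sigma^2+\omega^2$, and $o\in\{0,\dots,T-1\}$ is an index such that the probability $$\Pr(o=k)=\frac{\eta_k(3-2L\eta_k)}{\sum_{t=0}^{T-1}\eta_t(3-2L\eta_t)},\qquad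 \forall k=0,\dots,T-1.$$
   Context: $\lVert\cdot\rVert$ is the Euclidean norm on $\mathbb R^d$. Empty sums are $0$ (so the $t=0$ terms of the last two sums vanish). Compressor: an operator $\mathcal C:\mathbb R^d\to\mathbb R^d$ is a $\delta$-compressor, for a number $\delta\in(0,1)$, if $\mathbf E_{\mathcal C}\lVert\mathcal C(x)-x\rVert^2\le(1-\delta)\lVert x\rVert^2$ for all $x\in\mathbb R^d$, where the expectation $\mathbf E_{\mathcal C}$ is taken over the randomness of $\mathcal C$. Loss: given a loss function $\mathcal L(x,\xi)$, $f(x)=\mathbf E_\xi[\mathcal L(x,\xi)]$, where $x\in\mathbb R^d$ is the model parameter and $\xi$ is a data batch drawn from some unknown distribution. Algorithm dist-EF-SGD. Inputs: $\mathcal L$, learning rates $\{\eta_t\}$ with $\eta_{-1}=0$, number of workers $M$, compressor $\mathcal C$. Initialize $x_0\in\mathbb R^d$, $e_{0,i}=0\in\mathbb R^d$ on each worker $i=1,\dots,M$, and $\tilde e_0=0\in\mathbb R^d$ on the server. For $t=0,\dots,T-1$: each worker $i$ picks data $\xi_{t,i}$ from the dataset and computes $g_{t,i}=\nabla\mathcal L(x_t,\xi_{t,i})$ (stochastic gradient), $p_{t,i}=g_{t,i}+\frac{\eta_{t-1}}{\eta_t}e_{t,i}$, $\Delta_{t,i}=\mathcal C(p_{t,i})$, $e_{t+1,i}=p_{t,i}-\Delta_{t,i}$; the server computes $\tilde p_t=\frac1M\sum_{i=1}^M\Delta_{t,i}+\frac{\eta_{t-1}}{\eta_t}\tilde e_t$,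 $\tilde\Delta_t=\mathcal C(\tilde p_t)$, $\tilde e_{t+1}=\tilde p_t-\tilde\Delta_t$; and all workers update $x_{t+1}=x_t-\eta_t\tilde\Delta_t$. $\mathbf E_t$ denotes the expectation at iteration $t$ (i.e. given what happened before iteration $t$, in particular given $x_t$); $\mathbf E$ is total expectation. The expectation of $\lVert\nabla f(x_o)\rVert^2$ is also over $o$, and means $\sum_{k=0}^{T-1}\Pr(o=k)\,\mathbf E[\lVert\nabla f(x_k)\rVert^2]$. Assumption 1: $f$ is lower-bounded, $f^\star=\inf_{x\in\mathbb R^d}f(x)>-\infty$, and $L$-smooth, i.e. $f$ is differentiable and there is a constant $L\ge0$ such that $\lVert\nabla f(x)-\nabla f(y)\rVert\le L\lVert x-y\rVert$ for all $x,y\in\mathbb R^d$ (the bound $\frac{3}{2L}$ is read as $+\infty$ if $L=0$). Assumption 2: $\mathbf E_t[g_{t,i}]=\nabla f(x_t)$ and $\mathbf E_t[\lVert g_{t,i}-\nabla f(x_t)\rVert^2]\le\sigma^2$. Assumption 3: the full gradient is uniformly bounded, $\lVert\nabla f(x_t)\rVert^2\le\omega^2$.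
   Formalization: The data picked by different workers in one round are assumed conditionally independent given the past (the factor 1/M fails if all workers share the same data), and every call of the compressor uses fresh randomness independent of its input. *)

theory Defs
  imports "HOL-Probability.Probability"
begin

definition grad :: "('a::euclidean_space \<Rightarrow> real) \<Rightarrow> 'a \<Rightarrow> 'a" where
  "grad f x = (THE D. GDERIV f x :> D)"

lemma grad_eqI:
  assumes "GDERIV f x :> D"
  shows "grad f x = D"
  unfolding grad_def
proof (rule the_equality[where P = "\<lambda>D. GDERIV f x :> D", OF assms])
  fix D' assume "GDERIV f x :> D'"
  then have "(\<lambda>h. inner h D') = (\<lambda>h. inner h D)"
    using assms has_derivative_unique unfolding gderiv_def by blast
  then show "D' = D"
    by (metis inner_commute vector_eq_ldot)
qed

text \<open>A randomized operator is a map \<open>C r\<close> depending on a seed \<open>r\<close> with law \<open>R\<close>; a deterministic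
  operator is one that ignores its seed. The expectation is a nonnegative Lebesgue integral, so
  that the inequality also asserts its finiteness.\<close>

definition compressor ::
    "'r measure \<Rightarrow> ('r \<Rightarrow> 'a::euclidean_space \<Rightarrow> 'a) \<Rightarrow> real \<Rightarrow> bool" where
  "compressor R C \<delta> \<longleftrightarrow>
     prob_space R \<and>
     (\<lambda>(r, x). C r x) \<in> borel_measurable (R \<Otimes>\<^sub>M borel) \<and>
     0 < \<delta> \<and> \<delta> < 1 \<and>
     (\<forall>x. (\<integral>\<^sup>+ r. ennreal ((norm (C r x - x))\<^sup>2) \<partial>R) \<le> ennreal ((1 - \<delta>) * (norm x)\<^sup>2))"

definition loss_function ::
    "'d measure \<Rightarrow> ('a::euclidean_space \<Rightarrow> 'd \<Rightarrow> real) \<Rightarrow> bool" where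
  "loss_function D loss \<longleftrightarrow>
     prob_space D \<and>
     (\<lambda>(x, z). loss x z) \<in> borel_measurable (borel \<Otimes>\<^sub>M D) \<and>
     (\<forall>x. integrable D (loss x)) \<and>
     (\<forall>z\<in>space D. \<forall>x. (\<lambda>y. loss y z) differentiable (at x))"

definition risk :: "'d measure \<Rightarrow> ('a::euclidean_space \<Rightarrow> 'd \<Rightarrow> real) \<Rightarrow> 'a \<Rightarrow> real" where
  "risk D loss x = (\<integral>z. loss x z \<partial>D)"

text \<open>One realization of dist-EF-SGD with \<open>M\<close> workers \<open>i < M\<close>. The arguments \<open>\<xi> t i\<close>, \<open>\<rho> t i\<close> and
  \<open>\<rho>S t\<close> are the realized data of worker \<open>i\<close>, the seed of its compressor call and the seed of the
  server's compressor call in round \<open>t\<close>. Learning rates are indexed by integers because the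
  algorithm refers to \<open>\<eta> (-1)\<close>.\<close>

record 'a ef_state =
  model :: 'a
  worker_error :: "nat \<Rightarrow> 'a"
  server_error :: 'a

primrec dist_ef_sgd ::
    "('a::euclidean_space \<Rightarrow> 'd \<Rightarrow> real) \<Rightarrow> ('r \<Rightarrow> 'a \<Rightarrow> 'a) \<Rightarrow> (int \<Rightarrow> real) \<Rightarrow> nat \<Rightarrow> 'a \<Rightarrow>
     (nat \<Rightarrow> nat \<Rightarrow> 'd) \<Rightarrow> (nat \<Rightarrow> nat \<Rightarrow> 'r) \<Rightarrow> (nat \<Rightarrow> 'r) \<Rightarrow> nat \<Rightarrow> 'a ef_state" where
  "dist_ef_sgd loss C \<eta> M x0 \<xi> \<rho> \<rho>S 0 =
     \<lparr>model = x0, worker_error = (\<lambda>i. 0), server_error = 0\<rparr>"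
| "dist_ef_sgd loss C \<eta> M x0 \<xi> \<rho> \<rho>S (Suc t) =
     (let s = dist_ef_sgd loss C \<eta> M x0 \<xi> \<rho> \<rho>S t;
          q = \<eta> (int t - 1) / \<eta> (int t);
          g = (\<lambda>i. grad (\<lambda>y. loss y (\<xi> t i)) (model s));
          p = (\<lambda>i. g i + q *\<^sub>R worker_error s i);
          \<Delta> = (\<lambda>i. C (\<rho> t i) (p i));
          pS = (1 / real M) *\<^sub>R (\<Sum>i<M. \<Delta> i) + q *\<^sub>R server_error s;
          \<Delta>S = C (\<rho>S t) pS
      in \<lparr>model = model s - \<eta> (int t) *\<^sub>R \<Delta>S,
          worker_error = (\<lambda>i. p i - \<Delta> i),
          server_error = pS - \<Delta>S\<rparr>)"

text \<open>The \<open>\<sigma>\<close>-algebra generated by the data drawn in rounds \<open>< a\<close>, the worker seeds of rounds \<open>< b\<close>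
  and the server seeds of rounds \<open>< c\<close>. A round first draws the data, then the worker seeds, then
  the server seed, so \<open>history \<dots> t t t\<close> is what happened before round \<open>t\<close>.\<close>

definition history ::
    "'w measure \<Rightarrow> 'd measure \<Rightarrow> 'r measure \<Rightarrow> nat \<Rightarrow> (nat \<Rightarrow> nat \<Rightarrow> 'w \<Rightarrow> 'd) \<Rightarrow>
     (nat \<Rightarrow> nat \<Rightarrow> 'w \<Rightarrow> 'r) \<Rightarrow> (nat \<Rightarrow> 'w \<Rightarrow> 'r) \<Rightarrow> nat \<Rightarrow> nat \<Rightarrow> nat \<Rightarrow> 'w measure" where
  "history P D R M \<xi> \<rho> \<rho>S a b c = sigma (space P)
     ({\<xi> s i -` A \<inter> space P | s i A. s < a \<and> i < M \<and> A \<in> sets D} \<union>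
      {\<rho> s i -` A \<inter> space P | s i A. s < b \<and> i < M \<and> A \<in> sets R} \<union>
      {\<rho>S s -` A \<inter> space P | s A. s < c \<and> A \<in> sets R})"

definition cond_exp_vec ::
    "'w measure \<Rightarrow> 'w measure \<Rightarrow> ('w \<Rightarrow> 'a::euclidean_space) \<Rightarrow> 'w \<Rightarrow> 'a" where
  "cond_exp_vec P F X w = (\<Sum>b\<in>Basis. real_cond_exp P F (\<lambda>v. X v \<bullet> b) w *\<^sub>R b)"

text \<open>Mutual conditional independence of a family of random variables with finite index set \<open>I\<close>,
  given \<open>F\<close>. Subfamilies are covered by taking \<open>A i = space N\<close>.\<close>

definition cond_indep_vars ::
    "'w measure \<Rightarrow> 'w measure \<Rightarrow> 'd measure \<Rightarrow> ('i \<Rightarrow> 'w \<Rightarrow> 'd) \<Rightarrow> 'i set \<Rightarrow> bool" where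
  "cond_indep_vars P F N X I \<longleftrightarrow>
     (\<forall>i\<in>I. X i \<in> measurable P N) \<and>
     (\<forall>A. (\<forall>i\<in>I. A i \<in> sets N) \<longrightarrow>
        (AE w in P. real_cond_exp P F (indicator {v\<in>space P. \<forall>i\<in>I. X i v \<in> A i}) w =
           (\<Prod>i\<in>I. real_cond_exp P F (indicator (X i -` A i \<inter> space P)) w)))"

definition fresh_seed :: "'w measure \<Rightarrow> 'w measure \<Rightarrow> 'r measure \<Rightarrow> ('w \<Rightarrow> 'r) \<Rightarrow> bool" where
  "fresh_seed P F R Y \<longleftrightarrow>
     Y \<in> measurable P R \<and> distr P R Y = R \<and>
     prob_space.indep_set P (sets F) (sets (vimage_algebra (space P) Y R))"

text \<open>The randomness of \<open>T\<close> rounds. Given the past, the workers draw their data independently of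
  each other; every compressor call uses a seed that is independent of its input. No law of
  \<open>\<xi> t i\<close> is prescribed, and the worker seeds of one round may depend on each other.\<close>

definition sampling ::
    "'w measure \<Rightarrow> 'd measure \<Rightarrow> 'r measure \<Rightarrow> nat \<Rightarrow> nat \<Rightarrow> (nat \<Rightarrow> nat \<Rightarrow> 'w \<Rightarrow> 'd) \<Rightarrow>
     (nat \<Rightarrow> nat \<Rightarrow> 'w \<Rightarrow> 'r) \<Rightarrow> (nat \<Rightarrow> 'w \<Rightarrow> 'r) \<Rightarrow> bool" where
  "sampling P D R M T \<xi> \<rho> \<rho>S \<longleftrightarrow>
     prob_space P \<and>
     (\<forall>t<T. cond_indep_vars P (history P D R M \<xi> \<rho> \<rho>S t t t) D (\<xi> t) {..<M} \<and>
        (\<forall>i<M. fresh_seed P (history P D R M \<xi> \<rho> \<rho>S (Suc t) t t) R (\<rho> t i)) \<and>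
        fresh_seed P (history P D R M \<xi> \<rho> \<rho>S (Suc t) (Suc t) t) R (\<rho>S t))"

end

theory Submission
  imports Defs
begin

text \<open>The actual iterates move along compressed, hence biased, directions, but what a compressor drops
  is stored in an error memory and fed back in the next round. The proof therefore follows the virtual
  iterates, that is, the actual ones minus the previous learning rate times everything that is still
  stored (lemma \<open>x_virt_Suc\<close>): they perform plain distributed stochastic gradient descent with the averaged stochastic gradients, and compression only
  shows in that these gradients are taken at the actual iterate, not at the virtual one. For an
  \<open>L\<close>-smooth function the descent inequality along the virtual iterates (lemma \<open>virtual_descent\<close>) loses
  \<open>L\<^sup>2\<close> times the squared distance of the two, which is the size of the stored errors, and the
  variance of the averaged gradient. Summing over all rounds telescopes the function values and bounds
  the weighted sum of squared gradient norms; the output index is drawn with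
  probabilities proportional to these weights.

  The stored errors do not pile up, because each compression shrinks the expected squared norm of what
  is left by \<open>1 - \<delta>\<close>. Half of this contraction absorbs the cross term with the new gradient, so the
  workers' errors satisfy a linear recursion with factor \<open>\<alpha> = 1 - \<delta> / 2\<close> whose solution is a
  geometrically weighted sum of squared learning rates (lemma \<open>worker_error_bound\<close>). The server's error
  obeys the same recursion, driven by the workers' messages instead of gradients, which gives the double
  sum (lemma \<open>server_error_bound\<close>).

  The probabilistic input consists of two facts. The seed of each compressor call is independent of
  its input, so that the bound for fixed inputs can be integrated (lemma
  \<open>compressor_error_second_moment\<close>). And the gradient noises of different workers are uncorrelated, so
  that averaging divides the variance by \<open>M\<close>; this needs conditional independence given the past to be
  extended from events about the data to functions of the past and the data (lemma
  \<open>cond_indep_uncorrelated\<close>).\<close>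

section \<open>Smooth functions\<close>

lemma differentiable_imp_GDERIV_grad:
  fixes f :: "'a::euclidean_space \<Rightarrow> real"
  assumes "f differentiable (at x)"
  shows "GDERIV f x :> grad f x"
proof -
  from assms obtain f' where f': "(f has_derivative f') (at x)"
    unfolding differentiable_def by blast
  then have lin: "linear f'"
    by (rule has_derivative_linear)
  have "f' = (\<lambda>h. inner h (adjoint f' 1))"
    using adjoint_works[OF lin, of _ 1] by auto
  with f' have "GDERIV f x :> adjoint f' 1"
    by (simp add: gderiv_def)
  then show ?thesis
    using grad_eqI by metis
qed

lemma GDERIV_line:
  assumes "GDERIV f (x + s *\<^sub>R h) :> D"
  shows "((\<lambda>r. f (x + r *\<^sub>R h)) has_real_derivative (D \<bullet> h)) (at s)"
proof -
  have 1: "((\<lambda>r. x + r *\<^sub>R h) has_derivative (\<lambda>r. r *\<^sub>R h)) (at s)"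
    by (auto intro!: derivative_eq_intros)
  have 2: "(f has_derivative (\<lambda>k. k \<bullet> D)) (at (x + s *\<^sub>R h))"
    using assms by (simp add: gderiv_def)
  have "((\<lambda>r. f (x + r *\<^sub>R h)) has_derivative (\<lambda>r. (r *\<^sub>R h) \<bullet> D)) (at s)"
    by (rule has_derivative_compose[OF 1 2])
  moreover have "(\<lambda>r. (r *\<^sub>R h) \<bullet> D) = (*) (D \<bullet> h)"
    by (auto simp: inner_commute)
  ultimately show ?thesis
    by (simp add: has_field_derivative_def)
qed

text \<open>Along the segment from \<open>x\<close> to \<open>x + h\<close>, the gap between \<open>f\<close> and its quadratic upper model at \<open>x\<close>
  has nonpositive derivative, because the gradient drifts by at most \<open>L\<close> times the distance
  travelled. This avoids integrating the gradient.\<close>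

lemma lipschitz_grad_descent:
  fixes f :: "'a::euclidean_space \<Rightarrow> real"
  assumes diff: "\<And>y. f differentiable (at y)" and lip: "L-lipschitz_on UNIV (grad f)"
  shows "f (x + h) \<le> f x + grad f x \<bullet> h + L / 2 * (norm h)\<^sup>2"
proof -
  define \<phi> where "\<phi> s = f (x + s *\<^sub>R h) - s * (grad f x \<bullet> h) - L / 2 * s\<^sup>2 * (norm h)\<^sup>2" for s
  have "\<phi> 1 \<le> \<phi> 0"
  proof (rule DERIV_nonpos_imp_nonincreasing[of 0 1])
    fix s :: real assume s: "0 \<le> s"
    have d: "(\<phi> has_real_derivative
        (grad f (x + s *\<^sub>R h) \<bullet> h - grad f x \<bullet> h - L * s * (norm h)\<^sup>2)) (at s)"
      unfolding \<phi>_def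
      by (auto intro!: derivative_eq_intros GDERIV_line differentiable_imp_GDERIV_grad diff)
    have "(grad f (x + s *\<^sub>R h) - grad f x) \<bullet> h \<le> norm (grad f (x + s *\<^sub>R h) - grad f x) * norm h"
      by (rule norm_cauchy_schwarz)
    also have "\<dots> \<le> (L * norm (s *\<^sub>R h)) * norm h"
      using lipschitz_onD[OF lip, of "x + s *\<^sub>R h" x] by (intro mult_right_mono) (auto simp: dist_norm)
    also have "\<dots> = L * s * (norm h)\<^sup>2"
      using s by (simp add: power2_eq_square)
    finally show "\<exists>y. (\<phi> has_real_derivative y) (at s) \<and> y \<le> 0"
      using d by (auto simp: inner_diff_left)
  qed simp
  then show ?thesis
    by (simp add: \<phi>_def)
qed

text \<open>Joint measurability of the loss passes to its gradient because every partial derivative is the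
  pointwise limit of difference quotients along the steps \<open>1 / (n + 1)\<close>.\<close>

lemma grad_loss_measurable:
  fixes loss :: "'a::euclidean_space \<Rightarrow> 'd \<Rightarrow> real"
  assumes "loss_function D loss"
  shows "(\<lambda>(x, z). grad (\<lambda>y. loss y z) x) \<in> borel_measurable (borel \<Otimes>\<^sub>M D)"
proof (rule iffD2[OF borel_measurable_euclidean_space], rule ballI)
  fix b :: 'a assume "b \<in> Basis"
  have meas [measurable]: "(\<lambda>(x, z). loss x z) \<in> borel_measurable (borel \<Otimes>\<^sub>M D)"
    using assms by (simp add: loss_function_def)
  define q where "q n = (\<lambda>(x, z). (loss (x + (1 / real (Suc n)) *\<^sub>R b) z - loss x z) / (1 / real (Suc n)))" for n
  have shift: "(\<lambda>(x, z). loss (x + c *\<^sub>R b) z) \<in> borel_measurable (borel \<Otimes>\<^sub>M D)" for c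
  proof -
    have "(\<lambda>w. (fst w + c *\<^sub>R b, snd w)) \<in> measurable (borel \<Otimes>\<^sub>M D) (borel \<Otimes>\<^sub>M D)"
      by measurable
    from measurable_compose[OF this meas] show ?thesis
      by (simp add: case_prod_beta)
  qed
  show "(\<lambda>w. (case w of (x, z) \<Rightarrow> grad (\<lambda>y. loss y z) x) \<bullet> b) \<in> borel_measurable (borel \<Otimes>\<^sub>M D)"
  proof (rule borel_measurable_LIMSEQ_real)
    show "q n \<in> borel_measurable (borel \<Otimes>\<^sub>M D)" for n
      unfolding q_def case_prod_beta
      using shift[of "1 / real (Suc n)", unfolded case_prod_beta] meas[unfolded case_prod_beta]
      by (intro borel_measurable_divide borel_measurable_diff borel_measurable_const)
  next
    fix w :: "'a \<times> 'd" assume "w \<in> space (borel \<Otimes>\<^sub>M D)"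
    then obtain x z where w: "w = (x, z)" and z: "z \<in> space D"
      by (auto simp: space_pair_measure)
    have "GDERIV (\<lambda>y. loss y z) x :> grad (\<lambda>y. loss y z) x"
      using assms z by (intro differentiable_imp_GDERIV_grad) (auto simp: loss_function_def)
    then have "((\<lambda>r. loss (x + r *\<^sub>R b) z) has_real_derivative (grad (\<lambda>y. loss y z) x \<bullet> b)) (at 0)"
      by (intro GDERIV_line) simp
    then have lim: "((\<lambda>h. (loss (x + h *\<^sub>R b) z - loss x z) / h) \<longlongrightarrow> grad (\<lambda>y. loss y z) x \<bullet> b) (at 0)"
      by (simp add: DERIV_def)
    have "filterlim (\<lambda>n. 1 / real (Suc n)) (at 0) sequentially"
      using LIMSEQ_inverse_real_of_nat by (intro filterlim_atI) (auto simp: field_simps)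
    from filterlim_compose[OF lim this]
    show "(\<lambda>n. q n w) \<longlonglongrightarrow> (case w of (x, z) \<Rightarrow> grad (\<lambda>y. loss y z) x) \<bullet> b"
      by (simp add: q_def w)
  qed
qed

section \<open>Random vectors with finite second moment\<close>

text \<open>All moment estimates take place in the space of square-integrable random vectors: it is closed
  under the linear operations of the algorithm, and products of two members are integrable, so the
  expectations that occur along a run are never default values of divergent integrals.\<close>

definition sq_int :: "'w measure \<Rightarrow> ('w \<Rightarrow> 'a::euclidean_space) \<Rightarrow> bool" where
  "sq_int P X \<longleftrightarrow> X \<in> borel_measurable P \<and> integrable P (\<lambda>w. (norm (X w))\<^sup>2)"

abbreviation (input) second_moment :: "'w measure \<Rightarrow> ('w \<Rightarrow> 'a::euclidean_space) \<Rightarrow> real" where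
  "second_moment P X \<equiv> (\<integral>w. (norm (X w))\<^sup>2 \<partial>P)"

lemma sq_int_measurable: "sq_int P X \<Longrightarrow> X \<in> borel_measurable P"
  and sq_int_integrable: "sq_int P X \<Longrightarrow> integrable P (\<lambda>w. (norm (X w))\<^sup>2)"
  by (auto simp: sq_int_def)

text \<open>The weight \<open>\<gamma>\<close> stays free: error feedback needs a factor close to \<open>1\<close> on the old error, at the
  price of a large factor on the new gradient.\<close>

lemma norm_add_sq_le_Young:
  fixes a b :: "'a::real_inner"
  assumes "0 < \<gamma>"
  shows "(norm (a + b))\<^sup>2 \<le> (1 + \<gamma>) * (norm a)\<^sup>2 + (1 + 1 / \<gamma>) * (norm b)\<^sup>2"
proof -
  have "0 \<le> (norm (\<gamma> *\<^sub>R a - b))\<^sup>2 / \<gamma>"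
    using assms by simp
  also have "\<dots> = \<gamma> * (norm a)\<^sup>2 - 2 * (a \<bullet> b) + (norm b)\<^sup>2 / \<gamma>"
    using assms unfolding power2_norm_eq_inner
    by (simp add: inner_diff_left inner_diff_right inner_commute field_simps)
  finally have "2 * (a \<bullet> b) \<le> \<gamma> * (norm a)\<^sup>2 + (norm b)\<^sup>2 / \<gamma>"
    by simp
  then show ?thesis
    unfolding power2_norm_eq_inner
    by (simp add: inner_add_left inner_add_right inner_commute algebra_simps)
qed

lemma inner_le_half_sq:
  fixes a b :: "'a::real_inner"
  shows "\<bar>a \<bullet> b\<bar> \<le> ((norm a)\<^sup>2 + (norm b)\<^sup>2) / 2"
proof -
  have "\<bar>a \<bullet> b\<bar> \<le> norm a * norm b"
    by (rule Cauchy_Schwarz_ineq2)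
  also have "\<dots> \<le> ((norm a)\<^sup>2 + (norm b)\<^sup>2) / 2"
    using sum_squares_bound[of "norm a" "norm b"] by simp
  finally show ?thesis .
qed

lemma norm_sq_average_le:
  fixes v :: "nat \<Rightarrow> 'a::real_normed_vector"
  shows "(norm ((1 / real M) *\<^sub>R (\<Sum>i<M. v i)))\<^sup>2 \<le> (1 / real M) * (\<Sum>i<M. (norm (v i))\<^sup>2)"
proof (cases "M = 0")
  case False
  have "(norm (\<Sum>i<M. v i))\<^sup>2 \<le> (\<Sum>i<M. norm (v i))\<^sup>2"
    by (intro power_mono norm_sum) simp
  also have "\<dots> \<le> real M * (\<Sum>i<M. (norm (v i))\<^sup>2)"
    using sum_squared_le_sum_of_squares[of "\<lambda>i. norm (v i)" "{..<M}"]
    by (simp add: mult.commute)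
  finally have "(1 / real M)\<^sup>2 * (norm (\<Sum>i<M. v i))\<^sup>2 \<le> (1 / real M)\<^sup>2 * (real M * (\<Sum>i<M. (norm (v i))\<^sup>2))"
    by (intro mult_left_mono) simp_all
  then show ?thesis
    using False by (simp add: power_mult_distrib power2_eq_square field_simps)
qed simp

lemma sq_int_bound:
  assumes "X \<in> borel_measurable P" "integrable P u" "AE w in P. (norm (X w))\<^sup>2 \<le> u w"
  shows "sq_int P X"
  unfolding sq_int_def
proof
  show "integrable P (\<lambda>w. (norm (X w))\<^sup>2)"
    using assms by (intro Bochner_Integration.integrable_bound[OF assms(2)]) auto
qed fact

lemma sq_int_add:
  assumes "sq_int P X" "sq_int P Y"
  shows "sq_int P (\<lambda>w. X w + Y w)"
proof (rule sq_int_bound)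
  show "(\<lambda>w. X w + Y w) \<in> borel_measurable P"
    using assms by (intro borel_measurable_add sq_int_measurable)
  show "integrable P (\<lambda>w. 2 * (norm (X w))\<^sup>2 + 2 * (norm (Y w))\<^sup>2)"
    using assms by (auto simp: sq_int_def)
  show "AE w in P. (norm (X w + Y w))\<^sup>2 \<le> 2 * (norm (X w))\<^sup>2 + 2 * (norm (Y w))\<^sup>2"
    using norm_add_sq_le_Young[of 1 "X _" "Y _"] by simp
qed

lemma sq_int_scaleR: "sq_int P X \<Longrightarrow> sq_int P (\<lambda>w. c *\<^sub>R X w)"
  by (auto simp: sq_int_def power_mult_distrib)

lemma sq_int_diff: "sq_int P X \<Longrightarrow> sq_int P Y \<Longrightarrow> sq_int P (\<lambda>w. X w - Y w)"
  using sq_int_add[OF _ sq_int_scaleR[of P Y "-1"]] by simp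

lemma sq_int_zero: "sq_int P (\<lambda>w. 0)"
  by (simp add: sq_int_def)

lemma sq_int_sum:
  assumes "\<And>i. i \<in> I \<Longrightarrow> sq_int P (X i)"
  shows "sq_int P (\<lambda>w. \<Sum>i\<in>I. X i w)"
  using assms by (induction I rule: infinite_finite_induct) (auto intro: sq_int_add sq_int_zero)

lemma sq_int_inner:
  assumes "sq_int P X" "sq_int P Y"
  shows "integrable P (\<lambda>w. X w \<bullet> Y w)"
proof (rule Bochner_Integration.integrable_bound)
  show "integrable P (\<lambda>w. ((norm (X w))\<^sup>2 + (norm (Y w))\<^sup>2) / 2)"
    using assms by (auto simp: sq_int_def)
  show "(\<lambda>w. X w \<bullet> Y w) \<in> borel_measurable P"
    using assms by (auto simp: sq_int_def)
  show "AE w in P. norm (X w \<bullet> Y w) \<le> norm (((norm (X w))\<^sup>2 + (norm (Y w))\<^sup>2) / 2)"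
    using inner_le_half_sq by auto
qed

lemma sq_int_component:
  assumes "sq_int P X" shows "sq_int P (\<lambda>w. X w \<bullet> b)"
proof (rule sq_int_bound)
  show "integrable P (\<lambda>w. (norm b)\<^sup>2 * (norm (X w))\<^sup>2)"
    using assms by (simp add: sq_int_def)
  have "(norm (X w \<bullet> b))\<^sup>2 \<le> (norm (X w) * norm b)\<^sup>2" for w
    using Cauchy_Schwarz_ineq2[of "X w" b] by (intro power_mono) auto
  then show "AE w in P. (norm (X w \<bullet> b))\<^sup>2 \<le> (norm b)\<^sup>2 * (norm (X w))\<^sup>2"
    by (simp add: power_mult_distrib mult.commute)
qed (use sq_int_measurable[OF assms] in measurable)

lemma sq_int_nn_bound:
  assumes X: "X \<in> borel_measurable P" and c: "0 \<le> c"
    and le: "(\<integral>\<^sup>+ w. ennreal ((norm (X w))\<^sup>2) \<partial>P) \<le> ennreal c"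
  shows "sq_int P X" "second_moment P X \<le> c"
proof -
  show int: "sq_int P X"
    unfolding sq_int_def
  proof
    show "integrable P (\<lambda>w. (norm (X w))\<^sup>2)"
      using X le le_less_trans[OF le ennreal_less_top] by (intro integrableI_nonneg) auto
  qed fact
  have "ennreal (second_moment P X) \<le> ennreal c"
    using le nn_integral_eq_integral[OF sq_int_integrable[OF int]] by simp
  then show "second_moment P X \<le> c"
    using c by simp
qed

lemma second_moment_add_Young:
  assumes "sq_int P X" "sq_int P Y" "0 < \<gamma>"
  shows "second_moment P (\<lambda>w. X w + Y w)
    \<le> (1 + \<gamma>) * second_moment P X + (1 + 1 / \<gamma>) * second_moment P Y"
proof -
  have "second_moment P (\<lambda>w. X w + Y w)
    \<le> (\<integral>w. (1 + \<gamma>) * (norm (X w))\<^sup>2 + (1 + 1 / \<gamma>) * (norm (Y w))\<^sup>2 \<partial>P)"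
    using assms sq_int_integrable[OF sq_int_add[OF assms(1,2)]]
    by (intro integral_mono norm_add_sq_le_Young) (auto simp: sq_int_def)
  also have "\<dots> = (1 + \<gamma>) * second_moment P X + (1 + 1 / \<gamma>) * second_moment P Y"
    using assms by (simp add: sq_int_def)
  finally show ?thesis .
qed

lemma second_moment_scaleR:
  "second_moment P (\<lambda>w. c *\<^sub>R X w) = c\<^sup>2 * second_moment P X"
  by (simp add: power_mult_distrib)

lemma second_moment_average_le:
  assumes "\<And>i. i < M \<Longrightarrow> sq_int P (X i)" "\<And>i. i < M \<Longrightarrow> second_moment P (X i) \<le> c" "0 < M"
  shows "second_moment P (\<lambda>w. (1 / real M) *\<^sub>R (\<Sum>i<M. X i w)) \<le> c"
proof -
  have si: "sq_int P (\<lambda>w. (1 / real M) *\<^sub>R (\<Sum>i<M. X i w))"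
    by (intro sq_int_scaleR sq_int_sum) (use assms in auto)
  have "second_moment P (\<lambda>w. (1 / real M) *\<^sub>R (\<Sum>i<M. X i w))
    \<le> (\<integral>w. (1 / real M) * (\<Sum>i<M. (norm (X i w))\<^sup>2) \<partial>P)"
    using assms by (intro integral_mono norm_sq_average_le sq_int_integrable[OF si]
        integrable_mult_right Bochner_Integration.integrable_sum sq_int_integrable) auto
  also have "\<dots> = (1 / real M) * (\<Sum>i<M. second_moment P (X i))"
    using assms by (simp add: sq_int_def)
  also have "\<dots> \<le> (1 / real M) * (\<Sum>i<M. c)"
    using assms by (intro mult_left_mono sum_mono) auto
  finally show ?thesis
    using assms by simp
qed

section \<open>Compression of an independent input\<close>

text \<open>The compressor bound is an expectation over the seed for a fixed input. A fresh seed is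
  independent of the past, hence of the input \<open>X\<close>, so the joint law of \<open>X\<close> and \<open>Y\<close> is a product and
  Tonelli's theorem applies the bound to each value of the input separately.\<close>

lemma compressor_error_second_moment:
  fixes C :: "'r \<Rightarrow> 'a::euclidean_space \<Rightarrow> 'a"
  assumes "prob_space P" and comp: "compressor R C \<delta>" and sub: "subalgebra P H"
    and fresh: "fresh_seed P H R Y" and XH: "X \<in> borel_measurable H" and X: "sq_int P X"
  shows "sq_int P (\<lambda>w. X w - C (Y w) (X w))"
    and "second_moment P (\<lambda>w. X w - C (Y w) (X w)) \<le> (1 - \<delta>) * second_moment P X"
proof -
  interpret prob_space P by fact
  have XP [measurable]: "X \<in> borel_measurable P"
    by (rule sq_int_measurable[OF X])
  have Ym [measurable]: "Y \<in> measurable P R" and dY: "distr P R Y = R"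
    and ind: "indep_set (sets H) (sets (vimage_algebra (space P) Y R))"
    using fresh by (auto simp: fresh_seed_def)
  have Cm [measurable]: "(\<lambda>(r, x). C r x) \<in> borel_measurable (R \<Otimes>\<^sub>M borel)"
    and \<delta>: "0 < \<delta>" "\<delta> < 1" and "prob_space R"
    and Cb: "\<And>x. (\<integral>\<^sup>+ r. ennreal ((norm (C r x - x))\<^sup>2) \<partial>R) \<le> ennreal ((1 - \<delta>) * (norm x)\<^sup>2)"
    using comp by (auto simp: compressor_def)
  interpret R: prob_space R by fact
  have joint: "distr P borel X \<Otimes>\<^sub>M R = distr P (borel \<Otimes>\<^sub>M R) (\<lambda>w. (X w, Y w))"
  proof (rule pair_measure_eqI)
    show "sigma_finite_measure (distr P borel X)"
      by (intro prob_space_imp_sigma_finite prob_space_distr XP)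
    show "sigma_finite_measure R"
      by (intro prob_space_imp_sigma_finite \<open>prob_space R\<close>)
    fix A B assume A [measurable]: "A \<in> sets (distr P borel X)" and B [measurable]: "B \<in> sets R"
    have "X -` A \<inter> space P \<in> sets H"
      using measurable_sets[OF XH, of A] A sub by (simp add: subalgebra_def)
    moreover have "Y -` B \<inter> space P \<in> sets (vimage_algebra (space P) Y R)"
      using B by (rule in_vimage_algebra)
    ultimately have "prob ((X -` A \<inter> space P) \<inter> (Y -` B \<inter> space P))
        = prob (X -` A \<inter> space P) * prob (Y -` B \<inter> space P)"
      using ind unfolding indep_sets2_eq by blast
    moreover have "(\<lambda>w. (X w, Y w)) -` (A \<times> B) \<inter> space P = (X -` A \<inter> space P) \<inter> (Y -` B \<inter> space P)"
      by auto
    moreover have "emeasure R B = emeasure P (Y -` B \<inter> space P)"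
      using emeasure_distr[OF Ym B] dY by simp
    ultimately show "emeasure (distr P borel X) A * emeasure R B
        = emeasure (distr P (borel \<Otimes>\<^sub>M R) (\<lambda>w. (X w, Y w))) (A \<times> B)"
      using A by (simp add: emeasure_distr emeasure_eq_measure ennreal_mult)
  qed simp
  let ?h = "\<lambda>(x, r). ennreal ((norm (x - C r x))\<^sup>2)"
  have hm: "?h \<in> borel_measurable (borel \<Otimes>\<^sub>M R)"
  proof -
    have "(\<lambda>w. (snd w, fst w)) \<in> measurable (borel \<Otimes>\<^sub>M R) (R \<Otimes>\<^sub>M (borel :: 'a measure))"
      by measurable
    from measurable_compose[OF this Cm] have "(\<lambda>w. C (snd w) (fst w)) \<in> borel_measurable (borel \<Otimes>\<^sub>M R)"
      by simp
    then show ?thesis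
      unfolding case_prod_beta by measurable
  qed
  have CYX: "(\<lambda>w. C (Y w) (X w)) \<in> borel_measurable P"
    using measurable_compose[OF measurable_Pair[OF Ym XP] Cm] by simp
  have "(\<integral>\<^sup>+ w. ennreal ((norm (X w - C (Y w) (X w)))\<^sup>2) \<partial>P)
      = (\<integral>\<^sup>+ v. ?h v \<partial>distr P (borel \<Otimes>\<^sub>M R) (\<lambda>w. (X w, Y w)))"
    by (subst nn_integral_distr) (use hm in auto)
  also have "\<dots> = (\<integral>\<^sup>+ v. ?h v \<partial>(distr P borel X \<Otimes>\<^sub>M R))"
    by (simp add: joint)
  also have "\<dots> = (\<integral>\<^sup>+ x. \<integral>\<^sup>+ r. ?h (x, r) \<partial>R \<partial>distr P borel X)"
    by (intro R.nn_integral_fst[symmetric]) (use hm in simp)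
  also have "\<dots> \<le> (\<integral>\<^sup>+ x. ennreal ((1 - \<delta>) * (norm x)\<^sup>2) \<partial>distr P borel X)"
    using Cb by (intro nn_integral_mono) (simp add: norm_minus_commute)
  also have "\<dots> = (\<integral>\<^sup>+ w. ennreal ((1 - \<delta>) * (norm (X w))\<^sup>2) \<partial>P)"
    by (subst nn_integral_distr) auto
  also have "\<dots> = ennreal ((1 - \<delta>) * second_moment P X)"
    using X \<delta> by (subst nn_integral_eq_integral) (auto simp: sq_int_def)
  finally have le: "(\<integral>\<^sup>+ w. ennreal ((norm (X w - C (Y w) (X w)))\<^sup>2) \<partial>P)
      \<le> ennreal ((1 - \<delta>) * second_moment P X)" .
  have m: "(\<lambda>w. X w - C (Y w) (X w)) \<in> borel_measurable P"
    using CYX XP by simp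
  have "0 \<le> (1 - \<delta>) * second_moment P X"
    using \<delta> by simp
  from sq_int_nn_bound[OF m this le]
  show "sq_int P (\<lambda>w. X w - C (Y w) (X w))"
    and "second_moment P (\<lambda>w. X w - C (Y w) (X w)) \<le> (1 - \<delta>) * second_moment P X"
    by auto
qed

section \<open>Conditional independence\<close>

lemma prob_sigma_finite_subalgebra:
  assumes "prob_space P" "subalgebra P F"
  shows "sigma_finite_subalgebra P F"
proof -
  interpret prob_space P by fact
  interpret finite_measure_subalgebra P F
    by unfold_locales fact
  show ?thesis by unfold_locales
qed

text \<open>A Dynkin argument for signed densities: the sets on which \<open>u\<close> integrates to zero are closed under
  complements and disjoint unions.\<close>

lemma set_integral_zero_generator:
  fixes u :: "'w \<Rightarrow> real"
  assumes u: "integrable P u" and G: "Int_stable G" "G \<subseteq> sets P" "space P \<in> G"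
    and zero: "\<And>A. A \<in> G \<Longrightarrow> (\<integral>w\<in>A. u w \<partial>P) = 0"
    and A: "A \<in> sigma_sets (space P) G"
  shows "(\<integral>w\<in>A. u w \<partial>P) = 0"
proof -
  have GP: "G \<subseteq> Pow (space P)"
    using G(2) sets.space_closed by blast
  have sub: "sigma_sets (space P) G \<subseteq> sets P"
    using G(2) by (rule sets.sigma_sets_subset)
  have si: "set_integrable P A u" if "A \<in> sets P" for A
    using integrable_mult_indicator[OF that u] by (simp add: set_integrable_def)
  show ?thesis
    using G(1) GP A
  proof (induction rule: sigma_sets_induct_disjoint)
    case (basic A) then show ?case by (rule zero)
  next
    case empty then show ?case by (simp add: set_lebesgue_integral_def)
  next
    case (compl A)
    then have [measurable]: "A \<in> sets P" using sub by auto
    have "(\<integral>w\<in>space P. u w \<partial>P) = (\<integral>w\<in>A \<union> (space P - A). u w \<partial>P)"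
      using sets.sets_into_space[OF \<open>A \<in> sets P\<close>] by (simp add: Un_absorb1)
    also have "\<dots> = (\<integral>w\<in>A. u w \<partial>P) + (\<integral>w\<in>space P - A. u w \<partial>P)"
      by (intro set_integral_Un si) auto
    finally show ?case
      using compl zero[OF G(3)] by simp
  next
    case (union A)
    then have m: "A i \<in> sets P" for i using sub by auto
    have "(\<integral>w\<in>(\<Union>i. A i). u w \<partial>P) = (\<Sum>i. \<integral>w\<in>A i. u w \<partial>P)"
      using union(1) m by (intro lebesgue_integral_countable_add si) (auto simp: disjoint_family_on_def)
    then show ?case
      using union by simp
  qed
qed

text \<open>Vanishing of the integrals of \<open>u\<close> over the generator says that \<open>u\<close> has conditional expectation
  zero given the generated \<open>\<sigma>\<close>-algebra, so \<open>u\<close> is orthogonal to everything measurable there.\<close>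

lemma integral_mult_zero_generator:
  fixes u v :: "'w \<Rightarrow> real"
  assumes P: "prob_space P" and u: "integrable P u" and G: "Int_stable G" "G \<subseteq> sets P" "space P \<in> G"
    and zero: "\<And>A. A \<in> G \<Longrightarrow> (\<integral>w\<in>A. u w \<partial>P) = 0"
    and v: "v \<in> borel_measurable (sigma (space P) G)" and vu: "integrable P (\<lambda>w. v w * u w)"
  shows "(\<integral>w. v w * u w \<partial>P) = 0"
proof -
  let ?H = "sigma (space P) G"
  have GP: "G \<subseteq> Pow (space P)"
    using G(2) sets.space_closed by blast
  have "subalgebra P ?H"
    using GP sets.sigma_sets_subset[OF G(2)] by (auto simp: subalgebra_def)
  then interpret sigma_finite_subalgebra P ?H
    by (rule prob_sigma_finite_subalgebra[OF P])
  have "AE w in P. real_cond_exp P ?H u w = (\<lambda>_. 0) w"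
    using GP by (intro real_cond_exp_charact) (auto simp: u set_integral_zero_generator[OF u G zero])
  then have "(\<integral>w. v w * real_cond_exp P ?H u w \<partial>P) = (\<integral>w. 0 \<partial>P)"
    using vu measurable_from_subalg[OF subalg v] by (intro integral_cong_AE) auto
  then show ?thesis
    using real_cond_exp_intg(2)[OF vu v borel_measurable_integrable[OF u]] by simp
qed

text \<open>An intersection-stable generator of the \<open>\<sigma>\<close>-algebra generated by \<open>F\<close> together with the random
  variable \<open>X\<close>.\<close>

definition join_rects :: "'w measure \<Rightarrow> 'd measure \<Rightarrow> ('w \<Rightarrow> 'd) \<Rightarrow> 'w set set" where
  "join_rects F N X = {A \<inter> (X -` B \<inter> space F) | A B. A \<in> sets F \<and> B \<in> sets N}"

lemma join_rects_Int_stable: "Int_stable (join_rects F N X)"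
proof (rule Int_stableI)
  fix a b assume "a \<in> join_rects F N X" "b \<in> join_rects F N X"
  then obtain A B A' B' where "a = A \<inter> (X -` B \<inter> space F)" "b = A' \<inter> (X -` B' \<inter> space F)"
    "A \<in> sets F" "B \<in> sets N" "A' \<in> sets F" "B' \<in> sets N"
    unfolding join_rects_def by blast
  then show "a \<inter> b \<in> join_rects F N X"
    unfolding join_rects_def
    by (intro CollectI exI[of _ "A \<inter> A'"] exI[of _ "B \<inter> B'"]) auto
qed

lemma join_rects_subset:
  assumes "subalgebra P F" "X \<in> measurable P N"
  shows "join_rects F N X \<subseteq> sets P"
  using assms measurable_sets[OF assms(2)] unfolding join_rects_def subalgebra_def by auto

lemma space_in_join_rects:
  assumes "X \<in> space F \<rightarrow> space N" shows "space F \<in> join_rects F N X"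
  unfolding join_rects_def
  by (intro CollectI exI[of _ "space F"] exI[of _ "space N"]) (use assms in auto)

lemma measurable_join_rects_base:
  assumes "u \<in> measurable F K" "X \<in> space F \<rightarrow> space N"
  shows "u \<in> measurable (sigma (space F) (join_rects F N X)) K"
proof -
  have pow: "join_rects F N X \<subseteq> Pow (space F)"
    unfolding join_rects_def by auto
  have "sets F \<subseteq> join_rects F N X"
  proof
    fix A assume "A \<in> sets F"
    moreover have "A = A \<inter> (X -` space N \<inter> space F)"
      using assms(2) sets.sets_into_space[OF \<open>A \<in> sets F\<close>] by auto
    ultimately show "A \<in> join_rects F N X"
      unfolding join_rects_def by blast
  qed
  then have "sets F \<subseteq> sets (sigma (space F) (join_rects F N X))"
    using pow by auto
  then have "subalgebra (sigma (space F) (join_rects F N X)) F"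
    using pow by (simp add: subalgebra_def)
  then show ?thesis
    by (rule measurable_from_subalg[OF _ assms(1)])
qed

lemma measurable_join_rects_var:
  assumes "X \<in> space F \<rightarrow> space N"
  shows "X \<in> measurable (sigma (space F) (join_rects F N X)) N"
proof (rule measurableI)
  have pow: "join_rects F N X \<subseteq> Pow (space F)"
    unfolding join_rects_def by auto
  fix B assume "B \<in> sets N"
  then have "space F \<inter> (X -` B \<inter> space F) \<in> join_rects F N X"
    unfolding join_rects_def by blast
  then show "X -` B \<inter> space (sigma (space F) (join_rects F N X)) \<in> sets (sigma (space F) (join_rects F N X))"
    using pow by (auto simp: Int_commute)
qed (use assms in \<open>auto simp: space_measure_of_conv\<close>)

text \<open>Independence of a pair is read off from that of the family by leaving the other variables
  unconstrained; their factors are conditional probabilities of the sure event, which equal \<open>1\<close>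
  only almost everywhere.\<close>

lemma cond_indep_vars_pairD:
  assumes "prob_space P" "subalgebra P F" and ci: "cond_indep_vars P F N X I"
    and I: "finite I" "i \<in> I" "j \<in> I" "i \<noteq> j" and A: "A \<in> sets N" and B: "B \<in> sets N"
  shows "AE w in P. real_cond_exp P F (indicator ((X i -` A \<inter> space P) \<inter> (X j -` B \<inter> space P))) w
     = real_cond_exp P F (indicator (X i -` A \<inter> space P)) w * real_cond_exp P F (indicator (X j -` B \<inter> space P)) w"
proof -
  interpret prob_space P by fact
  interpret sigma_finite_subalgebra P F
    by (rule prob_sigma_finite_subalgebra) fact+
  define K where "K k = (if k = i then A else if k = j then B else space N)" for k
  have Xm: "X k \<in> measurable P N" if "k \<in> I" for k
    using ci that by (auto simp: cond_indep_vars_def)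
  have prod: "AE w in P. real_cond_exp P F (indicator {v\<in>space P. \<forall>k\<in>I. X k v \<in> K k}) w =
           (\<Prod>k\<in>I. real_cond_exp P F (indicator (X k -` K k \<inter> space P)) w)"
    using ci A B unfolding cond_indep_vars_def by (auto simp: K_def)
  have rect: "{v\<in>space P. \<forall>k\<in>I. X k v \<in> K k} = (X i -` A \<inter> space P) \<inter> (X j -` B \<inter> space P)"
    using I measurable_space[OF Xm] by (auto simp: K_def split: if_splits)
  have "AE w in P. \<forall>k\<in>I - {i, j}. real_cond_exp P F (indicator (X k -` K k \<inter> space P)) w = 1"
  proof (rule AE_finite_allI)
    fix k assume k: "k \<in> I - {i, j}"
    then have "X k -` K k \<inter> space P = space P"
      using measurable_space[OF Xm] by (auto simp: K_def)
    moreover have "AE w in P. real_cond_exp P F (indicator (space P)) w = 1"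
    proof -
      have "AE w in P. real_cond_exp P F (\<lambda>_. 1) w = 1"
        by (rule real_cond_exp_F_meas) auto
      moreover have "AE w in P. real_cond_exp P F (indicator (space P)) w = real_cond_exp P F (\<lambda>_. 1) w"
        by (rule real_cond_exp_cong) auto
      ultimately show ?thesis
        by eventually_elim simp
    qed
    ultimately show "AE w in P. real_cond_exp P F (indicator (X k -` K k \<inter> space P)) w = 1"
      by simp
  qed (use I in auto)
  with prod show ?thesis
  proof eventually_elim
    case (elim w)
    have "(\<Prod>k\<in>I. real_cond_exp P F (indicator (X k -` K k \<inter> space P)) w)
        = (\<Prod>k\<in>{i, j}. real_cond_exp P F (indicator (X k -` K k \<inter> space P)) w)"
      using I elim by (intro prod.mono_neutral_right) auto
    also have "\<dots> = real_cond_exp P F (indicator (X i -` A \<inter> space P)) w * real_cond_exp P F (indicator (X j -` B \<inter> space P)) w"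
      using I by (simp add: K_def)
    finally show ?case
      using elim by (simp add: rect)
  qed
qed

text \<open>Conditional independence is given only for events \<open>X i \<in> A\<close>, and the value space of the \<open>X i\<close> is
  an arbitrary measurable space, so regular conditional distributions need not exist. Instead the
  generator lemma is applied twice. Write \<open>h\<close> for the conditional probability of \<open>X j \<in> B\<close> given \<open>F\<close>.
  On the rectangles of \<open>F\<close> and \<open>X i\<close>, conditional independence says that the indicator of \<open>X j \<in> B\<close>
  and \<open>h\<close> have the same integrals; hence they can be exchanged against \<open>u\<close>, and against \<open>u\<close> the
  \<open>F\<close>-measurable \<open>h\<close> integrates to zero because \<open>u\<close> is centred given \<open>F\<close>. So \<open>u\<close> integrates to zero
  over all rectangles of \<open>F\<close> and \<open>X j\<close>, and is therefore orthogonal to \<open>v\<close>.\<close>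

lemma cond_indep_uncorrelated:
  fixes u v :: "'w \<Rightarrow> real"
  assumes P: "prob_space P" and F: "subalgebra P F" and ci: "cond_indep_vars P F N X I"
    and I: "finite I" "i \<in> I" "j \<in> I" "i \<noteq> j"
    and u: "u \<in> borel_measurable (sigma (space F) (join_rects F N (X i)))" "integrable P u"
    and v: "v \<in> borel_measurable (sigma (space F) (join_rects F N (X j)))"
    and uv: "integrable P (\<lambda>w. v w * u w)"
    and u0: "AE w in P. real_cond_exp P F u w = 0"
  shows "(\<integral>w. v w * u w \<partial>P) = 0"
proof -
  interpret prob_space P by fact
  interpret F: sigma_finite_subalgebra P F
    by (rule prob_sigma_finite_subalgebra) fact+
  have sp: "space F = space P"
    using F by (simp add: subalgebra_def)
  have Xm [measurable]: "X i \<in> measurable P N" "X j \<in> measurable P N"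
    using ci I by (auto simp: cond_indep_vars_def)
  then have Xs: "X i \<in> space F \<rightarrow> space N" "X j \<in> space F \<rightarrow> space N"
    using measurable_space[OF Xm(1)] measurable_space[OF Xm(2)] by (auto simp: sp)
  note gen = join_rects_Int_stable join_rects_subset[OF F Xm(1)] space_in_join_rects[OF Xs(1), unfolded sp]
  note gen' = join_rects_Int_stable join_rects_subset[OF F Xm(2)] space_in_join_rects[OF Xs(2), unfolded sp]
  have uP [measurable]: "u \<in> borel_measurable P"
    using u(2) by auto
  have fin: "integrable P (indicator A :: 'w \<Rightarrow> real)" if "A \<in> sets P" for A
    using that by (intro integrable_real_indicator) (auto simp: emeasure_eq_measure)
  have FP: "A \<in> sets P" if "A \<in> sets F" for A
    using F that by (auto simp: subalgebra_def)
  have null: "(\<integral>w\<in>A0 \<inter> (X j -` B \<inter> space F). u w \<partial>P) = 0"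
    if A0 [measurable]: "A0 \<in> sets F" and B [measurable]: "B \<in> sets N" for A0 B
  proof -
    note [measurable] = FP[OF A0]
    define EB where "EB = X j -` B \<inter> space P"
    have EB [measurable]: "EB \<in> sets P"
      by (simp add: EB_def)
    define h where "h = real_cond_exp P F (indicator EB)"
    have hF [measurable]: "h \<in> borel_measurable F"
      by (simp add: h_def)
    have hP [measurable]: "h \<in> borel_measurable P"
      by (rule measurable_from_subalg[OF F hF])
    have h01: "AE w in P. \<bar>h w\<bar> \<le> 1"
    proof -
      have "AE w in P. h w \<ge> 0"
        unfolding h_def by (rule F.real_cond_exp_ge_c[OF fin[OF EB]]) auto
      moreover have "AE w in P. h w \<le> 1"
        unfolding h_def by (rule F.real_cond_exp_le_c[OF fin[OF EB]]) (auto simp: indicator_def)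
      ultimately show ?thesis by eventually_elim auto
    qed
    have hb: "integrable P (\<lambda>w. s w * h w)" if "integrable P s" for s :: "'w \<Rightarrow> real"
    proof (rule Bochner_Integration.integrable_bound[OF that])
      show "AE w in P. norm (s w * h w) \<le> norm (s w)"
        using h01 by eventually_elim (auto simp: abs_mult intro: mult_left_le)
    qed (use borel_measurable_integrable[OF that] in measurable)
    have bb: "integrable P (\<lambda>w. s w * indicator E w)" if "integrable P s" "E \<in> sets P" for s :: "'w \<Rightarrow> real" and E
      using integrable_mult_indicator[OF that(2,1)] by (simp add: mult.commute)
    \<comment> \<open>the error made by exchanging the event \<open>X j \<in> B\<close> for its conditional probability\<close>
    define z where "z w = indicator EB w - h w" for w
    have z_int: "integrable P z"
      unfolding z_def using hb[of "\<lambda>_. 1"] fin[OF EB] by simp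
    have z_zero: "(\<integral>w\<in>A. z w \<partial>P) = 0" if "A \<in> join_rects F N (X i)" for A
    proof -
      from that obtain A1 A2 where A: "A = A1 \<inter> (X i -` A2 \<inter> space F)" and A1: "A1 \<in> sets F" and A2: "A2 \<in> sets N"
        unfolding join_rects_def by auto
      define EA where "EA = X i -` A2 \<inter> space P"
      have EA [measurable]: "EA \<in> sets P"
        using A2 by (simp add: EA_def)
      note [measurable] = A1 FP[OF A1]
      let ?a = "real_cond_exp P F (indicator EA)"
      have "(\<integral>w. indicator A1 w * indicator (EA \<inter> EB) w \<partial>P)
          = (\<integral>w. indicator A1 w * real_cond_exp P F (indicator (EA \<inter> EB)) w \<partial>P)"
        by (rule F.real_cond_exp_intg(2)[symmetric])
           (use FP[OF A1] EA EB A1 in \<open>auto intro!: bb fin\<close>)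
      also have "\<dots> = (\<integral>w. indicator A1 w * h w * ?a w \<partial>P)"
        using cond_indep_vars_pairD[OF P F ci I A2 B]
        by (intro integral_cong_AE)
           (auto simp: EA_def[symmetric] EB_def[symmetric] h_def elim!: eventually_mono)
      also have "\<dots> = (\<integral>w. indicator A1 w * h w * indicator EA w \<partial>P)"
        by (rule F.real_cond_exp_intg(2)) (use FP[OF A1] EA A1 in \<open>auto intro!: hb bb fin\<close>)
      finally have "(\<integral>w. indicator A1 w * indicator (EA \<inter> EB) w \<partial>P)
        = (\<integral>w. indicator A1 w * h w * indicator EA w \<partial>P)" .
      moreover have "(\<integral>w\<in>A. z w \<partial>P) = (\<integral>w. indicator A1 w * indicator (EA \<inter> EB) w - indicator A1 w * h w * indicator EA w \<partial>P)"
        unfolding set_lebesgue_integral_def z_def A sp EA_def[symmetric]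
        by (intro Bochner_Integration.integral_cong) (auto simp: indicator_def)
      moreover have "\<dots> = (\<integral>w. indicator A1 w * indicator (EA \<inter> EB) w \<partial>P) - (\<integral>w. indicator A1 w * h w * indicator EA w \<partial>P)"
        by (intro Bochner_Integration.integral_diff bb hb fin) auto
      ultimately show ?thesis by simp
    qed
    have Au: "(\<lambda>w. indicator A0 w * u w) \<in> borel_measurable (sigma (space P) (join_rects F N (X i)))"
      using measurable_join_rects_base[OF borel_measurable_indicator[OF A0] Xs(1)] u(1)
      unfolding sp by (rule borel_measurable_times)
    have Auz: "integrable P (\<lambda>w. indicator A0 w * u w * z w)"
    proof -
      have "integrable P (\<lambda>w. u w * indicator A0 w * indicator EB w - u w * indicator A0 w * h w)"
        by (intro Bochner_Integration.integrable_diff bb hb u) auto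
      then show ?thesis
        by (simp add: z_def algebra_simps)
    qed
    have "(\<integral>w. indicator A0 w * u w * z w \<partial>P) = 0"
      by (rule integral_mult_zero_generator[OF P z_int gen z_zero Au Auz])
    moreover have "(\<integral>w. indicator A0 w * u w * z w \<partial>P)
        = (\<integral>w. u w * indicator A0 w * indicator EB w - u w * indicator A0 w * h w \<partial>P)"
      by (simp add: z_def algebra_simps)
    moreover have "\<dots> = (\<integral>w. u w * indicator A0 w * indicator EB w \<partial>P) - (\<integral>w. u w * indicator A0 w * h w \<partial>P)"
      by (intro Bochner_Integration.integral_diff bb hb u) auto
    moreover have "(\<integral>w. u w * indicator A0 w * h w \<partial>P) = 0"
    proof -
      have "(\<integral>w. (indicator A0 w * h w) * u w \<partial>P) = (\<integral>w. (indicator A0 w * h w) * real_cond_exp P F u w \<partial>P)"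
        by (rule F.real_cond_exp_intg(2)[symmetric])
           (use hb[OF bb[OF u(2), of A0]] in \<open>auto simp: algebra_simps\<close>)
      also have "\<dots> = (\<integral>w. 0 \<partial>P)"
        using u0 by (intro integral_cong_AE) (auto elim!: eventually_mono)
      finally show ?thesis by (simp add: algebra_simps)
    qed
    moreover have "(\<integral>w\<in>A0 \<inter> (X j -` B \<inter> space F). u w \<partial>P) = (\<integral>w. u w * indicator A0 w * indicator EB w \<partial>P)"
      unfolding set_lebesgue_integral_def EB_def sp
      by (intro Bochner_Integration.integral_cong) (auto simp: indicator_def)
    ultimately show ?thesis by simp
  qed
  have null': "(\<integral>w\<in>A. u w \<partial>P) = 0" if "A \<in> join_rects F N (X j)" for A
    using that null unfolding join_rects_def by auto
  show ?thesis
    by (rule integral_mult_zero_generator[OF P u(2) gen' null' v[unfolded sp] uv])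
qed

section \<open>Centred random vectors\<close>

lemma cond_exp_vec_component:
  assumes "b \<in> Basis"
  shows "cond_exp_vec P F X w \<bullet> b = real_cond_exp P F (\<lambda>v. X v \<bullet> b) w"
  using assms by (simp add: cond_exp_vec_def)

definition centered :: "'w measure \<Rightarrow> 'w measure \<Rightarrow> ('w \<Rightarrow> 'a::euclidean_space) \<Rightarrow> bool" where
  "centered P F U \<longleftrightarrow> sq_int P U \<and>
     (\<forall>b\<in>Basis. AE w in P. real_cond_exp P F (\<lambda>v. U v \<bullet> b) w = 0)"

lemma sq_int_const: "prob_space P \<Longrightarrow> sq_int P (\<lambda>_. c)"
  using finite_measure.integrable_const[OF prob_space.finite_measure] by (auto simp: sq_int_def)

lemma sq_int_imp_integrable_component:
  assumes "prob_space P" "sq_int P X"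
  shows "integrable P (\<lambda>w. X w \<bullet> b)"
  by (rule sq_int_inner[OF assms(2) sq_int_const[OF assms(1)]])

lemma centered_diff_cond_exp:
  fixes X :: "'w \<Rightarrow> 'a::euclidean_space"
  assumes P: "prob_space P" and F: "subalgebra P F"
    and X: "sq_int P X" and Y: "sq_int P Y" "Y \<in> borel_measurable F"
    and XY: "AE w in P. cond_exp_vec P F X w = Y w"
  shows "centered P F (\<lambda>w. X w - Y w)"
  unfolding centered_def
proof (intro conjI ballI)
  show "sq_int P (\<lambda>w. X w - Y w)"
    by (rule sq_int_diff[OF X Y(1)])
  interpret sigma_finite_subalgebra P F
    by (rule prob_sigma_finite_subalgebra) fact+
  fix b :: 'a assume b: "b \<in> Basis"
  have iX: "integrable P (\<lambda>w. X w \<bullet> b)" and iY: "integrable P (\<lambda>w. Y w \<bullet> b)"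
    using P X Y(1) by (auto intro: sq_int_imp_integrable_component)
  have "AE w in P. real_cond_exp P F (\<lambda>w. Y w \<bullet> b) w = Y w \<bullet> b"
    using Y(2) by (intro real_cond_exp_F_meas iY) auto
  moreover have "AE w in P. real_cond_exp P F (\<lambda>w. X w \<bullet> b - Y w \<bullet> b) w
      = real_cond_exp P F (\<lambda>w. X w \<bullet> b) w - real_cond_exp P F (\<lambda>w. Y w \<bullet> b) w"
    by (rule real_cond_exp_diff[OF iX iY])
  ultimately show "AE w in P. real_cond_exp P F (\<lambda>w. (X w - Y w) \<bullet> b) w = 0"
    using XY by eventually_elim (simp add: inner_diff_left cond_exp_vec_component[OF b, symmetric])
qed

lemma integral_inner_Basis:
  assumes "sq_int P X" "sq_int P Y"
  shows "(\<integral>w. X w \<bullet> Y w \<partial>P) = (\<Sum>b\<in>Basis. \<integral>w. (X w \<bullet> b) * (Y w \<bullet> b) \<partial>P)"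
proof -
  have "(\<integral>w. X w \<bullet> Y w \<partial>P) = (\<integral>w. (\<Sum>b\<in>Basis. (X w \<bullet> b) * (Y w \<bullet> b)) \<partial>P)"
    by (intro Bochner_Integration.integral_cong refl euclidean_inner)
  also have "\<dots> = (\<Sum>b\<in>Basis. \<integral>w. (X w \<bullet> b) * (Y w \<bullet> b) \<partial>P)"
    using sq_int_inner[OF sq_int_component[OF assms(1)] sq_int_component[OF assms(2)]]
    by (intro Bochner_Integration.integral_sum) simp
  finally show ?thesis .
qed

lemma centered_orthogonal:
  assumes P: "prob_space P" and F: "subalgebra P F" and U: "centered P F U"
    and Z: "sq_int P Z" "Z \<in> borel_measurable F"
  shows "(\<integral>w. Z w \<bullet> U w \<partial>P) = 0"
proof -
  interpret sigma_finite_subalgebra P F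
    by (rule prob_sigma_finite_subalgebra) fact+
  have sU: "sq_int P U"
    using U by (simp add: centered_def)
  have "(\<integral>w. (Z w \<bullet> b) * (U w \<bullet> b) \<partial>P) = 0" if b: "b \<in> Basis" for b
  proof -
    have Zb: "(\<lambda>w. Z w \<bullet> b) \<in> borel_measurable F" and Ub: "(\<lambda>w. U w \<bullet> b) \<in> borel_measurable P"
      using Z(2) sq_int_measurable[OF sU] by auto
    have i: "integrable P (\<lambda>w. (Z w \<bullet> b) * (U w \<bullet> b))"
      using sq_int_inner[OF sq_int_component[OF Z(1)] sq_int_component[OF sU]] by simp
    have "(\<integral>w. (Z w \<bullet> b) * (U w \<bullet> b) \<partial>P) = (\<integral>w. (Z w \<bullet> b) * real_cond_exp P F (\<lambda>v. U v \<bullet> b) w \<partial>P)"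
      by (rule real_cond_exp_intg(2)[OF i Zb Ub, symmetric])
    also have "\<dots> = (\<integral>w. 0 \<partial>P)"
    proof (rule integral_cong_AE)
      have "AE w in P. real_cond_exp P F (\<lambda>v. U v \<bullet> b) w = 0"
        using U b by (auto simp: centered_def)
      then show "AE w in P. (Z w \<bullet> b) * real_cond_exp P F (\<lambda>v. U v \<bullet> b) w = 0"
        by eventually_elim simp
    qed (use measurable_from_subalg[OF F Zb] in auto)
    finally show ?thesis by simp
  qed
  then show ?thesis
    by (simp add: integral_inner_Basis[OF Z(1) sU])
qed

lemma second_moment_add_orthogonal:
  assumes "sq_int P X" "sq_int P Y" "(\<integral>w. X w \<bullet> Y w \<partial>P) = 0"
  shows "second_moment P (\<lambda>w. X w + Y w) = second_moment P X + second_moment P Y"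
proof -
  have "(norm (X w + Y w))\<^sup>2 = (norm (X w))\<^sup>2 + (norm (Y w))\<^sup>2 + 2 * (X w \<bullet> Y w)" for w
    unfolding power2_norm_eq_inner by (simp add: inner_add_left inner_add_right inner_commute)
  then show ?thesis
    using assms by (simp add: sq_int_integrable sq_int_inner)
qed

lemma second_moment_sum_orthogonal:
  fixes U :: "nat \<Rightarrow> 'w \<Rightarrow> 'a::euclidean_space"
  assumes "\<And>i. i < M \<Longrightarrow> sq_int P (U i)"
    and "\<And>i j. i < M \<Longrightarrow> j < M \<Longrightarrow> i \<noteq> j \<Longrightarrow> (\<integral>w. U i w \<bullet> U j w \<partial>P) = 0"
  shows "second_moment P (\<lambda>w. \<Sum>i<M. U i w) = (\<Sum>i<M. second_moment P (U i))"
  using assms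
proof (induction M)
  case (Suc M)
  have "(\<integral>w. (\<Sum>i<M. U i w) \<bullet> U M w \<partial>P) = (\<Sum>i<M. \<integral>w. U i w \<bullet> U M w \<partial>P)"
    using Suc.prems unfolding inner_sum_left
    by (intro Bochner_Integration.integral_sum sq_int_inner) auto
  also have "\<dots> = 0"
    using Suc.prems by (intro sum.neutral) auto
  finally have "second_moment P (\<lambda>w. (\<Sum>i<M. U i w) + U M w)
      = second_moment P (\<lambda>w. \<Sum>i<M. U i w) + second_moment P (U M)"
    using Suc.prems by (intro second_moment_add_orthogonal sq_int_sum) auto
  then show ?case
    using Suc by simp
qed simp

section \<open>A run of the algorithm\<close>

locale dist_ef_run =
  fixes P :: "'w measure" and D :: "'d measure" and R :: "'r measure"
    and loss :: "'a::euclidean_space \<Rightarrow> 'd \<Rightarrow> real"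
    and C :: "'r \<Rightarrow> 'a \<Rightarrow> 'a"
    and \<xi> :: "nat \<Rightarrow> nat \<Rightarrow> 'w \<Rightarrow> 'd"
    and \<rho> :: "nat \<Rightarrow> nat \<Rightarrow> 'w \<Rightarrow> 'r" and \<rho>S :: "nat \<Rightarrow> 'w \<Rightarrow> 'r"
    and \<eta> :: "int \<Rightarrow> real" and x0 :: 'a
    and M T :: nat and \<delta> :: real
  assumes workers: "M \<ge> 1"
    and loss_fun: "loss_function D loss"
    and comp: "compressor R C \<delta>"
    and sampling: "sampling P D R M T \<xi> \<rho> \<rho>S"
    and rate_init: "\<eta> (-1) = 0"
    and rate_pos: "0 < \<eta> (int t)"
begin

definition "state t w = dist_ef_sgd loss C \<eta> M x0 (\<lambda>s i. \<xi> s i w) (\<lambda>s i. \<rho> s i w) (\<lambda>s. \<rho>S s w) t"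
definition "x t w = model (state t w)"
definition "e t i w = worker_error (state t w) i"
definition "eS t w = server_error (state t w)"
definition "g t i w = grad (\<lambda>y. loss y (\<xi> t i w)) (x t w)"
definition "q t = \<eta> (int t - 1) / \<eta> (int t)"
definition "p t i w = g t i w + q t *\<^sub>R e t i w"
definition "\<Delta> t i w = C (\<rho> t i w) (p t i w)"
definition "pS t w = (1 / real M) *\<^sub>R (\<Sum>i<M. \<Delta> t i w) + q t *\<^sub>R eS t w"
definition "\<Delta>S t w = C (\<rho>S t w) (pS t w)"

text \<open>Summed over server and workers, the error memory holds what the compressors have withheld so far.
  The virtual iterate is the point that the algorithm would have reached had that part been applied
  as well.\<close>

definition "err t w = eS t w + (1 / real M) *\<^sub>R (\<Sum>i<M. e t i w)"
definition "g_avg t w = (1 / real M) *\<^sub>R (\<Sum>i<M. g t i w)"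

definition "x_virt t w = x t w - \<eta> (int t - 1) *\<^sub>R err t w"

lemma run_0: "x 0 w = x0" "e 0 i w = 0" "eS 0 w = 0"
  by (simp_all add: x_def e_def eS_def state_def)

lemma run_Suc:
  "x (Suc t) w = x t w - \<eta> (int t) *\<^sub>R \<Delta>S t w"
  "e (Suc t) i w = p t i w - \<Delta> t i w"
  "eS (Suc t) w = pS t w - \<Delta>S t w"
  unfolding x_def e_def eS_def g_def q_def p_def \<Delta>_def pS_def \<Delta>S_def state_def
  by (simp_all add: Let_def)

lemma x_virt_0: "x_virt 0 w = x0"
  by (simp add: x_virt_def err_def run_0 rate_init)

text \<open>What a compressor drops is exactly what enters its error memory, so all compressed messages
  cancel, and the ratio of learning rates in the feedback makes the old errors reappear with the
  weight they had before. What remains is a step of uncompressed distributed stochastic gradient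
  descent whose gradients are taken at the actual iterates.\<close>

lemma x_virt_Suc: "x_virt (Suc t) w = x_virt t w - \<eta> (int t) *\<^sub>R g_avg t w"
proof -
  have q: "\<eta> (int t) * q t = \<eta> (int t - 1)"
    using rate_pos[of t] by (simp add: q_def)
  have "x_virt (Suc t) w = x t w - \<eta> (int t) *\<^sub>R
      (q t *\<^sub>R eS t w + (1 / real M) *\<^sub>R (\<Sum>i<M. p t i w))"
    by (simp add: x_virt_def err_def run_Suc pS_def sum_subtractf algebra_simps)
  also have "\<dots> = x t w - \<eta> (int t) *\<^sub>R (q t *\<^sub>R err t w + g_avg t w)"
    by (simp add: p_def err_def g_avg_def sum.distrib scaleR_sum_right[symmetric] algebra_simps)
  also have "\<dots> = x_virt t w - \<eta> (int t) *\<^sub>R g_avg t w"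
    by (simp add: x_virt_def q[symmetric] algebra_simps)
  finally show ?thesis .
qed

abbreviation "H \<equiv> history P D R M \<xi> \<rho> \<rho>S"

lemma prob_P: "prob_space P"
  using sampling by (simp add: sampling_def)

lemma draws_measurable:
  assumes "t < T"
  shows "i < M \<Longrightarrow> \<xi> t i \<in> measurable P D" "i < M \<Longrightarrow> \<rho> t i \<in> measurable P R" "\<rho>S t \<in> measurable P R"
  using assms sampling by (auto simp: sampling_def cond_indep_vars_def fresh_seed_def)

lemma space_H [simp]: "space (H a b c) = space P"
  by (simp add: history_def space_measure_of_conv)

lemma sets_H: "sets (H a b c) = sigma_sets (space P)
     ({\<xi> s i -` A \<inter> space P | s i A. s < a \<and> i < M \<and> A \<in> sets D} \<union>
      {\<rho> s i -` A \<inter> space P | s i A. s < b \<and> i < M \<and> A \<in> sets R} \<union>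
      {\<rho>S s -` A \<inter> space P | s A. s < c \<and> A \<in> sets R})"
  unfolding history_def by (rule sets_measure_of) auto

lemma H_mono:
  assumes "a \<le> a'" "b \<le> b'" "c \<le> c'"
  shows "subalgebra (H a' b' c') (H a b c)"
  unfolding subalgebra_def sets_H space_H
proof (intro conjI refl sigma_sets_mono' Un_mono)
qed (use assms in \<open>blast intro: order_less_le_trans\<close>)+

lemma H_subalgebra:
  assumes "a \<le> T" "b \<le> T" "c \<le> T"
  shows "subalgebra P (H a b c)"
  unfolding subalgebra_def sets_H space_H
proof (intro conjI refl sets.sigma_sets_subset)
qed (use assms in \<open>auto intro!: measurable_sets[OF draws_measurable(1)] measurable_sets[OF draws_measurable(2)] measurable_sets[OF draws_measurable(3)]\<close>)

lemma draws_measurable_H: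
  assumes "t < T"
  shows "t < a \<Longrightarrow> i < M \<Longrightarrow> \<xi> t i \<in> measurable (H a b c) D"
    and "t < b \<Longrightarrow> i < M \<Longrightarrow> \<rho> t i \<in> measurable (H a b c) R"
    and "t < c \<Longrightarrow> \<rho>S t \<in> measurable (H a b c) R"
proof -
  show "\<xi> t i \<in> measurable (H a b c) D" if "t < a" "i < M"
  proof (rule measurableI)
    show "\<xi> t i w \<in> space D" if "w \<in> space (H a b c)" for w
      using measurable_space[OF draws_measurable(1)[OF assms \<open>i < M\<close>]] that by simp
    show "\<xi> t i -` A \<inter> space (H a b c) \<in> sets (H a b c)" if "A \<in> sets D" for A
      unfolding sets_H using that \<open>t < a\<close> \<open>i < M\<close> by (intro sigma_sets.Basic) auto
  qed
  show "\<rho> t i \<in> measurable (H a b c) R" if "t < b" "i < M"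
  proof (rule measurableI)
    show "\<rho> t i w \<in> space R" if "w \<in> space (H a b c)" for w
      using measurable_space[OF draws_measurable(2)[OF assms \<open>i < M\<close>]] that by simp
    show "\<rho> t i -` A \<inter> space (H a b c) \<in> sets (H a b c)" if "A \<in> sets R" for A
      unfolding sets_H using that \<open>t < b\<close> \<open>i < M\<close> by (intro sigma_sets.Basic) auto
  qed
  show "\<rho>S t \<in> measurable (H a b c) R" if "t < c"
  proof (rule measurableI)
    show "\<rho>S t w \<in> space R" if "w \<in> space (H a b c)" for w
      using measurable_space[OF draws_measurable(3)[OF assms]] that by simp
    show "\<rho>S t -` A \<inter> space (H a b c) \<in> sets (H a b c)" if "A \<in> sets R" for A
      unfolding sets_H using that \<open>t < c\<close> by (intro sigma_sets.Basic) auto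
  qed
qed

lemma g_measurable:
  assumes "x t \<in> borel_measurable K" "\<xi> t i \<in> measurable K D"
  shows "g t i \<in> borel_measurable K"
  using measurable_compose[OF measurable_Pair[OF assms] grad_loss_measurable[OF loss_fun]]
  by (simp add: g_def[abs_def])

lemma C_measurable:
  assumes "X \<in> borel_measurable K" "Y \<in> measurable K R"
  shows "(\<lambda>w. C (Y w) (X w)) \<in> borel_measurable K"
proof -
  have "(\<lambda>(r, x). C r x) \<in> borel_measurable (R \<Otimes>\<^sub>M borel)"
    using comp by (simp add: compressor_def)
  from measurable_compose[OF measurable_Pair[OF assms(2,1)] this] show ?thesis by simp
qed

text \<open>Within a round the \<open>\<sigma>\<close>-algebra of the past grows in the order of the draws: the input of each
  compressor is measurable with respect to the past of which its seed is independent.\<close>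

lemma p_measurable_if:
  assumes "x t \<in> borel_measurable (H t t t)" "e t i \<in> borel_measurable (H t t t)" "t < T" "i < M"
  shows "p t i \<in> borel_measurable (H (Suc t) t t)"
proof -
  have sub: "subalgebra (H (Suc t) t t) (H t t t)"
    by (rule H_mono) auto
  have "g t i \<in> borel_measurable (H (Suc t) t t)"
    using assms by (intro g_measurable measurable_from_subalg[OF sub] draws_measurable_H) auto
  then show ?thesis
    unfolding p_def[abs_def] using measurable_from_subalg[OF sub assms(2)] by measurable
qed

lemma \<Delta>_measurable_if:
  assumes "x t \<in> borel_measurable (H t t t)" "e t i \<in> borel_measurable (H t t t)" "t < T" "i < M"
  shows "\<Delta> t i \<in> borel_measurable (H (Suc t) (Suc t) t)"
  unfolding \<Delta>_def[abs_def]
proof (rule C_measurable)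
  show "p t i \<in> borel_measurable (H (Suc t) (Suc t) t)"
    by (rule measurable_from_subalg[OF H_mono p_measurable_if[OF assms]]) auto
  show "\<rho> t i \<in> measurable (H (Suc t) (Suc t) t) R"
    using assms by (intro draws_measurable_H) auto
qed

lemma pS_measurable_if:
  assumes "x t \<in> borel_measurable (H t t t)" "eS t \<in> borel_measurable (H t t t)"
    "\<And>i. i < M \<Longrightarrow> e t i \<in> borel_measurable (H t t t)" "t < T"
  shows "pS t \<in> borel_measurable (H (Suc t) (Suc t) t)"
proof -
  have "eS t \<in> borel_measurable (H (Suc t) (Suc t) t)"
    by (rule measurable_from_subalg[OF H_mono assms(2)]) auto
  moreover have "(\<lambda>w. \<Sum>i<M. \<Delta> t i w) \<in> borel_measurable (H (Suc t) (Suc t) t)"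
    using assms by (intro borel_measurable_sum \<Delta>_measurable_if) auto
  ultimately show ?thesis
    unfolding pS_def[abs_def] by measurable
qed

lemma state_measurable:
  assumes "t \<le> T"
  shows "x t \<in> borel_measurable (H t t t) \<and> eS t \<in> borel_measurable (H t t t) \<and>
    (\<forall>i<M. e t i \<in> borel_measurable (H t t t))"
  using assms
proof (induction t)
  case 0
  then show ?case
    by (simp add: run_0[abs_def])
next
  case (Suc t)
  then have t: "t < T" and IH: "x t \<in> borel_measurable (H t t t)" "eS t \<in> borel_measurable (H t t t)"
    "\<And>i. i < M \<Longrightarrow> e t i \<in> borel_measurable (H t t t)"
    by auto
  let ?N = "H (Suc t) (Suc t) (Suc t)"
  have pS: "pS t \<in> borel_measurable ?N"
    by (rule measurable_from_subalg[OF H_mono pS_measurable_if[OF IH t]]) auto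
  have \<Delta>S: "\<Delta>S t \<in> borel_measurable ?N"
    unfolding \<Delta>S_def[abs_def] by (intro C_measurable pS draws_measurable_H t) simp
  have "x (Suc t) \<in> borel_measurable ?N"
    using \<Delta>S measurable_from_subalg[OF H_mono IH(1), of "Suc t" "Suc t" "Suc t"]
    unfolding run_Suc[abs_def] by simp
  moreover have "eS (Suc t) \<in> borel_measurable ?N"
    unfolding run_Suc[abs_def] using \<Delta>S pS by simp
  moreover have "e (Suc t) i \<in> borel_measurable ?N" if "i < M" for i
  proof -
    have "p t i \<in> borel_measurable ?N"
      by (rule measurable_from_subalg[OF H_mono p_measurable_if]) (use IH t that in auto)
    moreover have "\<Delta> t i \<in> borel_measurable ?N"
      by (rule measurable_from_subalg[OF H_mono \<Delta>_measurable_if]) (use IH t that in auto)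
    ultimately show ?thesis
      unfolding run_Suc[abs_def] by simp
  qed
  ultimately show ?case by simp
qed

lemma measurable_H:
  assumes "t \<le> T"
  shows "x t \<in> borel_measurable (H t t t)" "eS t \<in> borel_measurable (H t t t)"
    "i < M \<Longrightarrow> e t i \<in> borel_measurable (H t t t)"
  using state_measurable[OF assms] by auto

lemma err_measurable:
  assumes "t \<le> T" shows "err t \<in> borel_measurable (H t t t)"
proof -
  have "(\<lambda>w. \<Sum>i<M. e t i w) \<in> borel_measurable (H t t t)"
    by (intro borel_measurable_sum measurable_H assms) auto
  then show ?thesis
    unfolding err_def[abs_def] using measurable_H(2)[OF assms] by measurable
qed

lemma x_virt_measurable:
  assumes "t \<le> T" shows "x_virt t \<in> borel_measurable (H t t t)"
  unfolding x_virt_def[abs_def] using err_measurable[OF assms] measurable_H(1)[OF assms] by measurable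

lemma g_measurable_P:
  assumes "t < T" "i < M" shows "g t i \<in> borel_measurable P"
  using assms
  by (intro g_measurable measurable_from_subalg[OF H_subalgebra[of t t t] measurable_H(1)] draws_measurable) auto

end

section \<open>Geometrically decayed sums\<close>

text \<open>The closed form of the recursion \<open>a (t + 1) = \<alpha> * a t + b t\<close> started at \<open>0\<close>. The double sum of the
  rate is such a sum whose input is again such a sum.\<close>

definition decayed_sum :: "real \<Rightarrow> (nat \<Rightarrow> real) \<Rightarrow> nat \<Rightarrow> real" where
  "decayed_sum \<alpha> b t = (\<Sum>j<t. \<alpha> ^ (t - 1 - j) * b j)"

lemma decayed_sum_0 [simp]: "decayed_sum \<alpha> b 0 = 0"
  by (simp add: decayed_sum_def)

lemma decayed_sum_Suc: "decayed_sum \<alpha> b (Suc t) = \<alpha> * decayed_sum \<alpha> b t + b t"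
proof -
  have "(\<Sum>j<t. \<alpha> ^ (t - j) * b j) = (\<Sum>j<t. \<alpha> * (\<alpha> ^ (t - 1 - j) * b j))"
  proof (rule sum.cong)
    fix j assume "j \<in> {..<t}"
    then have "t - j = Suc (t - 1 - j)" by auto
    then show "\<alpha> ^ (t - j) * b j = \<alpha> * (\<alpha> ^ (t - 1 - j) * b j)"
      by (simp only: power_Suc mult.assoc)
  qed simp
  then show ?thesis
    by (simp add: decayed_sum_def sum_distrib_left)
qed

lemma decayed_sum_reverse: "decayed_sum \<alpha> b t = (\<Sum>k<t. b (t - 1 - k) * \<alpha> ^ k)"
  unfolding decayed_sum_def
  by (subst sum.nat_diff_reindex[symmetric]) (auto intro!: sum.cong simp: mult.commute)

text \<open>One round of error feedback, with \<open>X\<close> the old error and \<open>Y\<close> the new message. The weight \<open>\<gamma>\<close> in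
  Young's inequality is chosen such that the factor \<open>1 - \<delta>\<close> of the compressor, which is carried by
  the bound on the old error, turns the factor \<open>1 + \<gamma>\<close> into \<open>1 - \<delta> / 2\<close>: half of the contraction is
  kept for decay, the other half pays for the cross term.\<close>

lemma Young_contraction_step:
  assumes X: "sq_int P X" and Y: "sq_int P Y" and \<delta>: "0 < \<delta>" "\<delta> < 1" and a: "0 < a"
    and YB: "a\<^sup>2 * second_moment P Y \<le> B" and XA: "b\<^sup>2 * second_moment P X \<le> (1 - \<delta>) * A"
  shows "a\<^sup>2 * second_moment P (\<lambda>w. Y w + (b / a) *\<^sub>R X w) \<le> (1 - \<delta> / 2) * A + (2 - \<delta>) / \<delta> * B"
proof -
  define \<gamma> where "\<gamma> = \<delta> / (2 * (1 - \<delta>))"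
  have \<gamma>: "0 < \<gamma>" "(1 + \<gamma>) * (1 - \<delta>) = 1 - \<delta> / 2" "1 + 1 / \<gamma> = (2 - \<delta>) / \<delta>"
    using \<delta> by (auto simp: \<gamma>_def field_simps)
  have "second_moment P (\<lambda>w. (b / a) *\<^sub>R X w + Y w)
      \<le> (1 + \<gamma>) * second_moment P (\<lambda>w. (b / a) *\<^sub>R X w) + (1 + 1 / \<gamma>) * second_moment P Y"
    by (intro second_moment_add_Young sq_int_scaleR X Y \<gamma>)
  then have "a\<^sup>2 * second_moment P (\<lambda>w. (b / a) *\<^sub>R X w + Y w)
      \<le> a\<^sup>2 * ((1 + \<gamma>) * second_moment P (\<lambda>w. (b / a) *\<^sub>R X w) + (1 + 1 / \<gamma>) * second_moment P Y)"
    by (rule mult_left_mono) simp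
  also have "\<dots> = (1 + \<gamma>) * (b\<^sup>2 * second_moment P X) + (2 - \<delta>) / \<delta> * (a\<^sup>2 * second_moment P Y)"
    using a unfolding second_moment_scaleR \<gamma>(3) by (simp add: power_divide field_simps)
  also have "\<dots> \<le> (1 + \<gamma>) * ((1 - \<delta>) * A) + (2 - \<delta>) / \<delta> * B"
    using \<gamma>(1) \<delta> by (intro add_mono mult_left_mono YB XA) auto
  also have "\<dots> = (1 - \<delta> / 2) * A + (2 - \<delta>) / \<delta> * B"
    by (simp add: \<gamma>(2)[symmetric])
  finally show ?thesis
    by (simp add: add.commute)
qed

section \<open>Gradient noise\<close>

locale dist_ef_run_smooth = dist_ef_run P D R loss C \<xi> \<rho> \<rho>S \<eta> x0 M T \<delta>
  for P :: "'w measure" and D :: "'d measure" and R :: "'r measure"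
    and loss :: "'a::euclidean_space \<Rightarrow> 'd \<Rightarrow> real"
    and C \<xi> \<rho> \<rho>S \<eta> x0 M T \<delta> +
  fixes f :: "'a \<Rightarrow> real" and L \<sigma> \<omega> fmin :: real
  assumes f_diff: "\<And>y. f differentiable (at y)"
    and f_lip: "L-lipschitz_on UNIV (grad f)"
    and f_lower: "\<And>y. fmin \<le> f y"
    and unbiased: "\<And>t i. t < T \<Longrightarrow> i < M \<Longrightarrow>
        AE w in P. cond_exp_vec P (H t t t) (g t i) w = grad f (x t w)"
    and variance: "\<And>t i. t < T \<Longrightarrow> i < M \<Longrightarrow> AE w in P.
        nn_cond_exp P (H t t t) (\<lambda>v. ennreal ((norm (g t i v - grad f (x t v)))\<^sup>2)) w \<le> ennreal (\<sigma>\<^sup>2)"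
    and bounded_gradient: "\<And>t. t < T \<Longrightarrow> AE w in P. (norm (grad f (x t w)))\<^sup>2 \<le> \<omega>\<^sup>2"
begin

lemma L_nonneg: "0 \<le> L"
  using f_lip by (rule lipschitz_on_nonneg)

lemma delta: "0 < \<delta>" "\<delta> < 1"
  using comp by (auto simp: compressor_def)

lemma grad_f_measurable: "grad f \<in> borel_measurable borel"
  using lipschitz_on_continuous_on[OF f_lip] by (rule borel_measurable_continuous_onI)

lemma f_measurable: "f \<in> borel_measurable borel"
  using f_diff
  by (intro borel_measurable_continuous_onI differentiable_imp_continuous_on)
     (simp add: differentiable_on_def differentiable_at_withinI)

definition "full_grad t w = grad f (x t w)"
definition "noise t i w = g t i w - full_grad t w"

lemma grad_measurable: "t \<le> T \<Longrightarrow> full_grad t \<in> borel_measurable (H t t t)"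
  unfolding full_grad_def[abs_def]
  by (rule measurable_compose[OF measurable_H(1) grad_f_measurable])

lemma H_sub: "t \<le> T \<Longrightarrow> subalgebra P (H t t t)"
  by (rule H_subalgebra)

lemma grad_sq_int:
  assumes "t < T" shows "sq_int P (full_grad t)" "second_moment P (full_grad t) \<le> \<omega>\<^sup>2"
proof -
  interpret prob_space P by (rule prob_P)
  have bd: "AE w in P. (norm (full_grad t w))\<^sup>2 \<le> \<omega>\<^sup>2"
    using bounded_gradient[OF assms] by (simp add: full_grad_def)
  show si: "sq_int P (full_grad t)"
    by (rule sq_int_bound[OF measurable_from_subalg[OF H_sub grad_measurable] _ bd]) (use assms in auto)
  have "second_moment P (full_grad t) \<le> (\<integral>w. \<omega>\<^sup>2 \<partial>P)"
    by (intro integral_mono_AE sq_int_integrable si bd) auto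
  then show "second_moment P (full_grad t) \<le> \<omega>\<^sup>2"
    by (simp add: prob_space)
qed

text \<open>The bound on the conditional variance is integrated as a nonnegative function. Only the
  square-integrability obtained here makes the hypothesis of unbiasedness, which is about conditional
  expectations of real functions, meaningful.\<close>

lemma noise_sq_int:
  assumes "t < T" "i < M" shows "sq_int P (noise t i)" "second_moment P (noise t i) \<le> \<sigma>\<^sup>2"
proof -
  interpret prob_space P by (rule prob_P)
  interpret sigma_finite_subalgebra P "H t t t"
    using assms by (intro prob_sigma_finite_subalgebra[OF prob_P H_sub]) simp
  have m: "noise t i \<in> borel_measurable P"
    unfolding noise_def[abs_def]
    using g_measurable_P[OF assms] measurable_from_subalg[OF H_sub grad_measurable, of t] assms by simp
  have "(\<integral>\<^sup>+ w. ennreal ((norm (noise t i w))\<^sup>2) \<partial>P)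
      = (\<integral>\<^sup>+ w. 1 * nn_cond_exp P (H t t t) (\<lambda>v. ennreal ((norm (noise t i v))\<^sup>2)) w \<partial>P)"
    using m by (subst nn_cond_exp_intg) auto
  also have "\<dots> \<le> (\<integral>\<^sup>+ w. ennreal (\<sigma>\<^sup>2) \<partial>P)"
    using variance[OF assms] by (intro nn_integral_mono_AE) (simp add: noise_def full_grad_def)
  also have "\<dots> = ennreal (\<sigma>\<^sup>2)"
    by (simp add: emeasure_space_1)
  finally have le: "(\<integral>\<^sup>+ w. ennreal ((norm (noise t i w))\<^sup>2) \<partial>P) \<le> ennreal (\<sigma>\<^sup>2)" .
  show "sq_int P (noise t i)" "second_moment P (noise t i) \<le> \<sigma>\<^sup>2"
    using sq_int_nn_bound[OF m _ le] by auto
qed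

lemma g_eq: "g t i = (\<lambda>w. full_grad t w + noise t i w)"
  by (simp add: noise_def)

lemma g_sq_int: "t < T \<Longrightarrow> i < M \<Longrightarrow> sq_int P (g t i)"
  unfolding g_eq by (intro sq_int_add grad_sq_int noise_sq_int)

lemma noise_centered:
  assumes "t < T" "i < M" shows "centered P (H t t t) (noise t i)"
  unfolding noise_def[abs_def]
  using assms unbiased[OF assms]
  by (intro centered_diff_cond_exp prob_P H_sub g_sq_int grad_sq_int grad_measurable)
     (auto simp: full_grad_def)

lemma noise_orthogonal_past:
  assumes "t < T" "i < M" "sq_int P Z" "Z \<in> borel_measurable (H t t t)"
  shows "(\<integral>w. Z w \<bullet> noise t i w \<partial>P) = 0"
  using assms by (intro centered_orthogonal[OF prob_P H_sub noise_centered]) auto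

lemma g_second_moment:
  assumes "t < T" "i < M" shows "second_moment P (g t i) \<le> \<sigma>\<^sup>2 + \<omega>\<^sup>2"
proof -
  have "second_moment P (\<lambda>w. full_grad t w + noise t i w) = second_moment P (full_grad t) + second_moment P (noise t i)"
    using assms
    by (intro second_moment_add_orthogonal grad_sq_int noise_sq_int noise_orthogonal_past grad_measurable) auto
  then show ?thesis
    unfolding g_eq using grad_sq_int(2)[OF assms(1)] noise_sq_int(2)[OF assms] by linarith
qed

text \<open>This is where the conditional independence of the workers' data enters; each coordinate of the
  noise of a worker is a function of the past and of that worker's data alone.\<close>

lemma noise_uncorrelated:
  assumes "t < T" "i < M" "j < M" "i \<noteq> j"
  shows "(\<integral>w. noise t i w \<bullet> noise t j w \<partial>P) = 0"
proof -
  have sub: "subalgebra P (H t t t)"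
    using assms by (intro H_sub) simp
  have meas: "noise t k \<in> borel_measurable (sigma (space (H t t t)) (join_rects (H t t t) D (\<xi> t k)))"
    if "k < M" for k
  proof -
    have sp: "\<xi> t k \<in> space (H t t t) \<rightarrow> space D"
      using measurable_space[OF draws_measurable(1)[OF assms(1) that]] by auto
    note base = measurable_join_rects_base[OF _ sp]
    show ?thesis
      unfolding noise_def[abs_def]
      using assms
      by (intro borel_measurable_diff g_measurable base measurable_H grad_measurable
            measurable_join_rects_var[OF sp]) auto
  qed
  have ci: "cond_indep_vars P (H t t t) D (\<xi> t) {..<M}"
    using sampling assms by (simp add: sampling_def)
  note si = noise_sq_int(1)[OF assms(1)]
  have "(\<integral>w. (noise t i w \<bullet> b) * (noise t j w \<bullet> b) \<partial>P) = 0" if b: "b \<in> Basis" for b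
  proof (rule cond_indep_uncorrelated[OF prob_P sub ci finite_lessThan, of j i])
    show "integrable P (\<lambda>w. noise t j w \<bullet> b)"
      using assms by (intro sq_int_imp_integrable_component prob_P si) auto
    show "integrable P (\<lambda>w. (noise t i w \<bullet> b) * (noise t j w \<bullet> b))"
      using sq_int_inner[OF sq_int_component[OF si] sq_int_component[OF si]] assms by simp
    show "AE w in P. real_cond_exp P (H t t t) (\<lambda>w. noise t j w \<bullet> b) w = 0"
      using noise_centered[OF assms(1,3)] b by (simp add: centered_def)
  qed (use assms meas in auto)
  then show ?thesis
    using assms by (simp add: integral_inner_Basis si)
qed

lemma average_noise:
  assumes "t < T"
  shows "sq_int P (\<lambda>w. (1 / real M) *\<^sub>R (\<Sum>i<M. noise t i w))"
    and "second_moment P (\<lambda>w. (1 / real M) *\<^sub>R (\<Sum>i<M. noise t i w)) \<le> \<sigma>\<^sup>2 / real M"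
proof -
  show "sq_int P (\<lambda>w. (1 / real M) *\<^sub>R (\<Sum>i<M. noise t i w))"
    using assms by (intro sq_int_scaleR sq_int_sum noise_sq_int) auto
  have "second_moment P (\<lambda>w. \<Sum>i<M. noise t i w) = (\<Sum>i<M. second_moment P (noise t i))"
    using assms by (intro second_moment_sum_orthogonal noise_sq_int noise_uncorrelated)
  also have "\<dots> \<le> (\<Sum>i<M. \<sigma>\<^sup>2)"
    using assms by (intro sum_mono noise_sq_int) auto
  finally have "(1 / real M)\<^sup>2 * second_moment P (\<lambda>w. \<Sum>i<M. noise t i w) \<le> (1 / real M)\<^sup>2 * (real M * \<sigma>\<^sup>2)"
    by (intro mult_left_mono) auto
  also have "\<dots> = \<sigma>\<^sup>2 / real M"
    using workers by (simp add: power2_eq_square field_simps)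
  finally show "second_moment P (\<lambda>w. (1 / real M) *\<^sub>R (\<Sum>i<M. noise t i w)) \<le> \<sigma>\<^sup>2 / real M"
    by (simp only: second_moment_scaleR)
qed

lemma g_avg_eq: "g_avg t w = full_grad t w + (1 / real M) *\<^sub>R (\<Sum>i<M. noise t i w)"
  using workers
  by (simp add: g_avg_def noise_def sum_subtractf scaleR_diff_right sum_constant_scaleR)

lemma g_avg_sq_int: "t < T \<Longrightarrow> sq_int P (g_avg t)"
  unfolding g_avg_eq[abs_def] by (intro sq_int_add grad_sq_int average_noise)

lemma integral_inner_g_avg:
  assumes "t < T" "sq_int P Z" "Z \<in> borel_measurable (H t t t)"
  shows "(\<integral>w. Z w \<bullet> g_avg t w \<partial>P) = (\<integral>w. Z w \<bullet> full_grad t w \<partial>P)"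
proof -
  have i1: "integrable P (\<lambda>w. Z w \<bullet> full_grad t w)"
    by (intro sq_int_inner grad_sq_int assms)
  have i2: "integrable P (\<lambda>w. Z w \<bullet> noise t i w)" if "i < M" for i
    by (intro sq_int_inner noise_sq_int assms that)
  have "(\<integral>w. Z w \<bullet> g_avg t w \<partial>P) = (\<integral>w. Z w \<bullet> full_grad t w + (1 / real M) * (\<Sum>i<M. Z w \<bullet> noise t i w) \<partial>P)"
    by (simp add: g_avg_eq inner_add_right inner_sum_right)
  also have "\<dots> = (\<integral>w. Z w \<bullet> full_grad t w \<partial>P) + (1 / real M) * (\<Sum>i<M. \<integral>w. Z w \<bullet> noise t i w \<partial>P)"
    using i1 i2
    by (subst Bochner_Integration.integral_add)
       (auto intro!: Bochner_Integration.integrable_sum integrable_divide Bochner_Integration.integral_sum)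
  also have "\<dots> = (\<integral>w. Z w \<bullet> full_grad t w \<partial>P)"
    using assms by (simp add: noise_orthogonal_past)
  finally show ?thesis .
qed

lemma g_avg_second_moment:
  assumes "t < T" shows "second_moment P (g_avg t) \<le> second_moment P (full_grad t) + \<sigma>\<^sup>2 / real M"
proof -
  have "(\<integral>w. full_grad t w \<bullet> ((1 / real M) *\<^sub>R (\<Sum>i<M. noise t i w)) \<partial>P)
      = (\<integral>w. (1 / real M) * (\<Sum>i<M. full_grad t w \<bullet> noise t i w) \<partial>P)"
    by (simp add: inner_sum_right)
  also have "\<dots> = (1 / real M) * (\<Sum>i<M. \<integral>w. full_grad t w \<bullet> noise t i w \<partial>P)"
    using assms sq_int_inner[OF grad_sq_int(1) noise_sq_int(1)] by simp
  also have "\<dots> = 0"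
    using assms by (simp add: noise_orthogonal_past grad_sq_int grad_measurable)
  finally show ?thesis
    unfolding g_avg_eq[abs_def]
    using second_moment_add_orthogonal[OF grad_sq_int(1)[OF assms] average_noise(1)[OF assms]]
      average_noise(2)[OF assms] by simp
qed

section \<open>Accumulated compression errors\<close>

definition "worker_sum t = decayed_sum (1 - \<delta> / 2) (\<lambda>j. (\<eta> (int j))\<^sup>2) t"
definition "server_sum t = decayed_sum (1 - \<delta> / 2) (\<lambda>j. worker_sum (Suc j)) t"

lemma worker_sum_Suc: "worker_sum (Suc t) = (1 - \<delta> / 2) * worker_sum t + (\<eta> (int t))\<^sup>2"
  by (simp add: worker_sum_def decayed_sum_Suc)

lemma server_sum_Suc: "server_sum (Suc t) = (1 - \<delta> / 2) * server_sum t + worker_sum (Suc t)"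
  by (simp add: server_sum_def decayed_sum_Suc)

text \<open>The factor \<open>1 - \<delta>\<close> of the error bounds is left out of the constants because the inputs of the
  compressors obey the same bounds without it. In \<open>server_const\<close>, the factor \<open>2 * (2 - \<delta>)\<close> is the cost
  of estimating a compressed message by its uncompressed version.\<close>

definition "worker_const = (2 - \<delta>) / \<delta> * (\<sigma>\<^sup>2 + \<omega>\<^sup>2)"
definition "server_const = (2 - \<delta>) / \<delta> * (2 * (2 - \<delta>) * worker_const)"

text \<open>Scaling by the learning rate of the round turns the ratio of learning rates in the feedback into
  the rate of the previous round, so the scaled second moments satisfy a recursion with constant
  decay factor.\<close>

lemma p_second_moment:
  assumes t: "t < T" "i < M" and e: "sq_int P (e t i)"
    and bd: "(\<eta> (int t - 1))\<^sup>2 * second_moment P (e t i) \<le> (1 - \<delta>) * (worker_const * worker_sum t)"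
  shows "sq_int P (p t i)" "(\<eta> (int t))\<^sup>2 * second_moment P (p t i) \<le> worker_const * worker_sum (Suc t)"
proof -
  show "sq_int P (p t i)"
    unfolding p_def[abs_def] using t e by (intro sq_int_add sq_int_scaleR g_sq_int)
  have "(\<eta> (int t))\<^sup>2 * second_moment P (g t i) \<le> (\<eta> (int t))\<^sup>2 * (\<sigma>\<^sup>2 + \<omega>\<^sup>2)"
    using t by (intro mult_left_mono g_second_moment) auto
  from Young_contraction_step[OF e g_sq_int[OF t] delta rate_pos[of t] this bd]
  have "(\<eta> (int t))\<^sup>2 * second_moment P (p t i)
      \<le> (1 - \<delta> / 2) * (worker_const * worker_sum t) + (2 - \<delta>) / \<delta> * ((\<eta> (int t))\<^sup>2 * (\<sigma>\<^sup>2 + \<omega>\<^sup>2))"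
    by (simp add: p_def q_def)
  also have "\<dots> = worker_const * worker_sum (Suc t)"
    unfolding worker_sum_Suc distrib_left[of worker_const] by (simp add: worker_const_def mult_ac)
  finally show "(\<eta> (int t))\<^sup>2 * second_moment P (p t i) \<le> worker_const * worker_sum (Suc t)" .
qed

lemma worker_error_bound:
  assumes "t \<le> T" "i < M"
  shows "sq_int P (e t i) \<and>
    (\<eta> (int t - 1))\<^sup>2 * second_moment P (e t i) \<le> (1 - \<delta>) * (worker_const * worker_sum t)"
  using assms(1)
proof (induction t)
  case 0
  then show ?case
    by (simp add: run_0[abs_def] worker_sum_def sq_int_zero)
next
  case (Suc t)
  then have t: "t < T" by simp
  note p = p_second_moment[OF t assms(2)]
  have IH: "sq_int P (e t i)" "(\<eta> (int t - 1))\<^sup>2 * second_moment P (e t i) \<le> (1 - \<delta>) * (worker_const * worker_sum t)"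
    using Suc by auto
  have fresh: "fresh_seed P (H (Suc t) t t) R (\<rho> t i)"
    using sampling t assms(2) by (simp add: sampling_def)
  have pm: "p t i \<in> borel_measurable (H (Suc t) t t)"
    using t assms(2) by (intro p_measurable_if measurable_H) auto
  have sub: "subalgebra P (H (Suc t) t t)"
    using t by (intro H_subalgebra) auto
  note c = compressor_error_second_moment[OF prob_P comp sub fresh pm p(1)[OF IH],
      folded \<Delta>_def run_Suc(2)[abs_def]]
  have "(\<eta> (int t))\<^sup>2 * second_moment P (e (Suc t) i) \<le> (\<eta> (int t))\<^sup>2 * ((1 - \<delta>) * second_moment P (p t i))"
    using c(2) by (intro mult_left_mono) (simp_all add: run_Suc[abs_def])
  also have "\<dots> = (1 - \<delta>) * ((\<eta> (int t))\<^sup>2 * second_moment P (p t i))"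
    by simp
  also have "\<dots> \<le> (1 - \<delta>) * (worker_const * worker_sum (Suc t))"
    using p(2)[OF IH] delta by (intro mult_left_mono) auto
  finally show ?case
    using c(1) by (simp add: run_Suc[abs_def])
qed

text \<open>A compressed message is its input minus the new error, both of which are already controlled.\<close>

lemma \<Delta>_second_moment:
  assumes t: "t < T" "i < M"
  shows "sq_int P (\<Delta> t i)" "(\<eta> (int t))\<^sup>2 * second_moment P (\<Delta> t i) \<le> 2 * (2 - \<delta>) * (worker_const * worker_sum (Suc t))"
proof -
  have e: "sq_int P (e t i)" "(\<eta> (int t - 1))\<^sup>2 * second_moment P (e t i) \<le> (1 - \<delta>) * (worker_const * worker_sum t)"
    using worker_error_bound[of t i] t by auto
  note p = p_second_moment[OF t e]
  have e': "sq_int P (e (Suc t) i)"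
    "(\<eta> (int t))\<^sup>2 * second_moment P (e (Suc t) i) \<le> (1 - \<delta>) * (worker_const * worker_sum (Suc t))"
    using worker_error_bound[of "Suc t" i] t by auto
  have \<Delta>: "\<Delta> t i = (\<lambda>w. p t i w + (-1) *\<^sub>R e (Suc t) i w)"
    by (simp add: run_Suc)
  show "sq_int P (\<Delta> t i)"
    unfolding \<Delta> by (intro sq_int_add sq_int_scaleR p e')
  have "second_moment P (\<Delta> t i) \<le> (1 + 1) * second_moment P (p t i)
      + (1 + 1 / 1) * second_moment P (\<lambda>w. (-1) *\<^sub>R e (Suc t) i w)"
    unfolding \<Delta> by (intro second_moment_add_Young sq_int_scaleR p e') simp
  then have "second_moment P (\<Delta> t i) \<le> 2 * second_moment P (p t i) + 2 * second_moment P (e (Suc t) i)"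
    by simp
  then have "(\<eta> (int t))\<^sup>2 * second_moment P (\<Delta> t i)
      \<le> (\<eta> (int t))\<^sup>2 * (2 * second_moment P (p t i) + 2 * second_moment P (e (Suc t) i))"
    by (rule mult_left_mono) simp
  also have "\<dots> \<le> 2 * (worker_const * worker_sum (Suc t)) + 2 * ((1 - \<delta>) * (worker_const * worker_sum (Suc t)))"
    using p(2) e'(2) by (simp add: algebra_simps)
  finally show "(\<eta> (int t))\<^sup>2 * second_moment P (\<Delta> t i) \<le> 2 * (2 - \<delta>) * (worker_const * worker_sum (Suc t))"
    by (simp add: algebra_simps)
qed

text \<open>The recursion of the workers once more, now driven by the average of their messages instead of a
  gradient; this makes the bound a double sum and squares \<open>1 / \<delta>\<close>.\<close>

lemma server_error_bound:
  assumes "t \<le> T"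
  shows "sq_int P (eS t) \<and>
    (\<eta> (int t - 1))\<^sup>2 * second_moment P (eS t) \<le> (1 - \<delta>) * (server_const * server_sum t)"
  using assms
proof (induction t)
  case 0
  then show ?case
    by (simp add: run_0[abs_def] server_sum_def sq_int_zero)
next
  case (Suc t)
  then have t: "t < T" by simp
  have IH: "sq_int P (eS t)" "(\<eta> (int t - 1))\<^sup>2 * second_moment P (eS t) \<le> (1 - \<delta>) * (server_const * server_sum t)"
    using Suc by auto
  define \<Delta>A where "\<Delta>A w = (1 / real M) *\<^sub>R (\<Sum>i<M. \<Delta> t i w)" for w
  have \<Delta>A: "sq_int P \<Delta>A"
    unfolding \<Delta>A_def[abs_def] using t by (intro sq_int_scaleR sq_int_sum \<Delta>_second_moment) auto
  have "second_moment P \<Delta>A \<le> 2 * (2 - \<delta>) * (worker_const * worker_sum (Suc t)) / (\<eta> (int t))\<^sup>2"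
    unfolding \<Delta>A_def
  proof (rule second_moment_average_le)
    fix i assume i: "i < M"
    show "second_moment P (\<Delta> t i) \<le> 2 * (2 - \<delta>) * (worker_const * worker_sum (Suc t)) / (\<eta> (int t))\<^sup>2"
      using \<Delta>_second_moment(2)[OF t i] rate_pos[of t] by (simp add: pos_le_divide_eq mult.commute)
  qed (use workers \<Delta>_second_moment(1)[OF t] in auto)
  then have \<Delta>B: "(\<eta> (int t))\<^sup>2 * second_moment P \<Delta>A \<le> 2 * (2 - \<delta>) * (worker_const * worker_sum (Suc t))"
    using rate_pos[of t] by (simp add: pos_le_divide_eq mult.commute)
  have pS_eq: "pS t = (\<lambda>w. \<Delta>A w + (\<eta> (int t - 1) / \<eta> (int t)) *\<^sub>R eS t w)"
    by (simp add: fun_eq_iff pS_def \<Delta>A_def q_def)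
  have pS: "sq_int P (pS t)"
    unfolding pS_eq by (intro sq_int_add sq_int_scaleR \<Delta>A IH)
  have "(\<eta> (int t))\<^sup>2 * second_moment P (pS t)
      \<le> (1 - \<delta> / 2) * (server_const * server_sum t) + (2 - \<delta>) / \<delta> * (2 * (2 - \<delta>) * (worker_const * worker_sum (Suc t)))"
    unfolding pS_eq by (rule Young_contraction_step[OF IH(1) \<Delta>A delta rate_pos[of t] \<Delta>B IH(2)])
  also have "\<dots> = server_const * server_sum (Suc t)"
    unfolding server_sum_Suc distrib_left[of server_const] by (simp add: server_const_def mult_ac)
  finally have pS_bd: "(\<eta> (int t))\<^sup>2 * second_moment P (pS t) \<le> server_const * server_sum (Suc t)" .
  have fresh: "fresh_seed P (H (Suc t) (Suc t) t) R (\<rho>S t)"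
    using sampling t by (simp add: sampling_def)
  have pm: "pS t \<in> borel_measurable (H (Suc t) (Suc t) t)"
    using t by (intro pS_measurable_if measurable_H) auto
  have sub: "subalgebra P (H (Suc t) (Suc t) t)"
    using t by (intro H_subalgebra) auto
  note c = compressor_error_second_moment[OF prob_P comp sub fresh pm pS, folded \<Delta>S_def]
  have "(\<eta> (int t))\<^sup>2 * second_moment P (eS (Suc t)) \<le> (\<eta> (int t))\<^sup>2 * ((1 - \<delta>) * second_moment P (pS t))"
    using c(2) by (intro mult_left_mono) (simp_all add: run_Suc[abs_def])
  also have "\<dots> = (1 - \<delta>) * ((\<eta> (int t))\<^sup>2 * second_moment P (pS t))"
    by simp
  also have "\<dots> \<le> (1 - \<delta>) * (server_const * server_sum (Suc t))"
    using pS_bd delta by (intro mult_left_mono) auto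
  finally show ?case
    using c(1) by (simp add: run_Suc[abs_def])
qed

lemma err_bound:
  assumes "t \<le> T"
  shows "sq_int P (err t)"
    and "(\<eta> (int t - 1))\<^sup>2 * second_moment P (err t) \<le> 2 * (1 - \<delta>) * (worker_const * worker_sum t + server_const * server_sum t)"
proof -
  define eA where "eA w = (1 / real M) *\<^sub>R (\<Sum>i<M. e t i w)" for w
  have e: "sq_int P (e t i)" "(\<eta> (int t - 1))\<^sup>2 * second_moment P (e t i) \<le> (1 - \<delta>) * (worker_const * worker_sum t)" if "i < M" for i
    using worker_error_bound[OF assms that] by auto
  have eA: "sq_int P eA"
    unfolding eA_def[abs_def] by (intro sq_int_scaleR sq_int_sum e) auto
  have eA_bd: "(\<eta> (int t - 1))\<^sup>2 * second_moment P eA \<le> (1 - \<delta>) * (worker_const * worker_sum t)"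
  proof -
    have avg_le: "second_moment P (\<lambda>w. (1 / real M) *\<^sub>R (\<Sum>i<M. \<eta> (int t - 1) *\<^sub>R e t i w)) \<le> (1 - \<delta>) * (worker_const * worker_sum t)"
      using workers by (intro second_moment_average_le sq_int_scaleR e)
        (auto simp only: second_moment_scaleR intro: e)
    have eq: "(\<lambda>w. (1 / real M) *\<^sub>R (\<Sum>i<M. \<eta> (int t - 1) *\<^sub>R e t i w)) = (\<lambda>w. \<eta> (int t - 1) *\<^sub>R eA w)"
      by (simp add: eA_def scaleR_sum_right[symmetric] mult.commute)
    have "second_moment P (\<lambda>w. (1 / real M) *\<^sub>R (\<Sum>i<M. \<eta> (int t - 1) *\<^sub>R e t i w))
        = (\<eta> (int t - 1))\<^sup>2 * second_moment P eA"
      unfolding fun_cong[OF eq] by (rule second_moment_scaleR)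
    with avg_le show ?thesis
      by linarith
  qed
  have err_eq: "err t = (\<lambda>w. eS t w + eA w)"
    by (simp add: fun_eq_iff err_def eA_def)
  have eS: "sq_int P (eS t)" "(\<eta> (int t - 1))\<^sup>2 * second_moment P (eS t) \<le> (1 - \<delta>) * (server_const * server_sum t)"
    using server_error_bound[OF assms] by auto
  show "sq_int P (err t)"
    unfolding err_eq by (intro sq_int_add eA eS)
  have "second_moment P (err t) \<le> 2 * second_moment P (eS t) + 2 * second_moment P eA"
    unfolding err_eq using second_moment_add_Young[OF eS(1) eA, of 1] by simp
  then have "(\<eta> (int t - 1))\<^sup>2 * second_moment P (err t)
      \<le> (\<eta> (int t - 1))\<^sup>2 * (2 * second_moment P (eS t) + 2 * second_moment P eA)"
    by (rule mult_left_mono) simp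
  also have "\<dots> \<le> 2 * ((1 - \<delta>) * (server_const * server_sum t)) + 2 * ((1 - \<delta>) * (worker_const * worker_sum t))"
    using eS(2) eA_bd by (simp add: algebra_simps)
  finally show "(\<eta> (int t - 1))\<^sup>2 * second_moment P (err t) \<le> 2 * (1 - \<delta>) * (worker_const * worker_sum t + server_const * server_sum t)"
    by (simp add: algebra_simps)
qed

section \<open>Descent along the virtual iterates\<close>

lemma x_virt_sq_int: "t \<le> T \<Longrightarrow> sq_int P (x_virt t)"
proof (induction t)
  case 0
  then show ?case
    by (simp add: x_virt_0[abs_def] sq_int_const[OF prob_P])
next
  case (Suc t)
  then show ?case
    unfolding x_virt_Suc[abs_def] by (intro sq_int_diff sq_int_scaleR g_avg_sq_int) auto
qed

text \<open>A smooth function that is bounded below grows at most quadratically.\<close>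

lemma f_x_virt_integrable:
  assumes "t \<le> T" shows "integrable P (\<lambda>w. f (x_virt t w))"
proof (rule Bochner_Integration.integrable_bound)
  interpret prob_space P by (rule prob_P)
  note X = x_virt_sq_int[OF assms]
  let ?u = "\<lambda>w. \<bar>fmin\<bar> + \<bar>f 0\<bar> + (\<bar>grad f 0 \<bullet> x_virt t w\<bar> + L / 2 * (norm (x_virt t w))\<^sup>2)"
  show "integrable P ?u"
    using sq_int_integrable[OF X] sq_int_inner[OF sq_int_const[OF prob_P] X]
    by (intro Bochner_Integration.integrable_add integrable_abs integrable_mult_right) auto
  show "(\<lambda>w. f (x_virt t w)) \<in> borel_measurable P"
    by (rule measurable_compose[OF sq_int_measurable[OF X] f_measurable])
  show "AE w in P. norm (f (x_virt t w)) \<le> norm (?u w)"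
  proof (intro AE_I2)
    fix w
    have "f (x_virt t w) \<le> f 0 + grad f 0 \<bullet> x_virt t w + L / 2 * (norm (x_virt t w))\<^sup>2"
      using lipschitz_grad_descent[OF f_diff f_lip, of 0 "x_virt t w"] by simp
    moreover have "0 \<le> L / 2 * (norm (x_virt t w))\<^sup>2"
      using L_nonneg by simp
    ultimately show "norm (f (x_virt t w)) \<le> norm (?u w)"
      using f_lower[of "x_virt t w"] by (auto simp: abs_le_iff)
  qed
qed

text \<open>The virtual step uses gradients at the actual iterate, so its expected first-order decrease is
  the inner product of the gradients at the two points. Its distance from the squared gradient norm is
  controlled by smoothness and the accumulated error; a quarter of the squared norm is spent on
  absorbing the linear dependence on that error, which leaves the coefficient \<open>3 / 4\<close>
  before the second-order term is subtracted.\<close>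

lemma virtual_descent:
  assumes t: "t < T"
  shows "(\<integral>w. f (x_virt (Suc t) w) \<partial>P) \<le> (\<integral>w. f (x_virt t w) \<partial>P)
    - \<eta> (int t) * (3 - 2 * L * \<eta> (int t)) / 4 * second_moment P (full_grad t)
    + \<eta> (int t) * L\<^sup>2 * ((\<eta> (int t - 1))\<^sup>2 * second_moment P (err t))
    + L * (\<eta> (int t))\<^sup>2 * \<sigma>\<^sup>2 / (2 * real M)"
proof -
  let ?h = "\<eta> (int t)" and ?h' = "\<eta> (int t - 1)"
  have h: "0 < ?h" by (rule rate_pos)
  define Gv where "Gv w = grad f (x_virt t w)" for w
  have errI: "sq_int P (err t)"
    using t by (intro err_bound) simp
  have gap: "(norm (Gv w - full_grad t w))\<^sup>2 \<le> L\<^sup>2 * (?h'\<^sup>2 * (norm (err t w))\<^sup>2)" for w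
  proof -
    have "norm (Gv w - full_grad t w) \<le> L * norm (?h' *\<^sub>R err t w)"
      using lipschitz_onD[OF f_lip, of "x_virt t w" "x t w"]
      by (simp add: Gv_def full_grad_def dist_norm x_virt_def norm_minus_commute)
    then have "(norm (Gv w - full_grad t w))\<^sup>2 \<le> (L * norm (?h' *\<^sub>R err t w))\<^sup>2"
      by (intro power_mono) auto
    then show ?thesis
      by (simp add: power_mult_distrib)
  qed
  have GvH: "Gv \<in> borel_measurable (H t t t)"
    unfolding Gv_def[abs_def] using t
    by (intro measurable_compose[OF x_virt_measurable grad_f_measurable]) simp
  have GvP: "Gv \<in> borel_measurable P"
    using t by (intro measurable_from_subalg[OF H_sub GvH]) simp
  have gI: "sq_int P (full_grad t)"
    by (rule grad_sq_int(1)[OF t])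
  have "sq_int P (\<lambda>w. Gv w - full_grad t w)"
  proof (rule sq_int_bound)
    show "(\<lambda>w. Gv w - full_grad t w) \<in> borel_measurable P"
      using GvP sq_int_measurable[OF gI] by simp
    show "integrable P (\<lambda>w. L\<^sup>2 * (?h'\<^sup>2 * (norm (err t w))\<^sup>2))"
      using sq_int_integrable[OF errI] by simp
  qed (use gap in simp)
  from sq_int_add[OF this gI] have GvI: "sq_int P Gv"
    by simp
  \<comment> \<open>completing the square; the weight \<open>1 / 2\<close> is the one that costs a quarter of the squared norm\<close>
  have cross: "- (Gv w \<bullet> full_grad t w) \<le> - (3 / 4) * (norm (full_grad t w))\<^sup>2 + L\<^sup>2 * (?h'\<^sup>2 * (norm (err t w))\<^sup>2)" for w
  proof -
    have "0 \<le> (norm ((Gv w - full_grad t w) + (1 / 2) *\<^sub>R full_grad t w))\<^sup>2"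
      by simp
    also have "\<dots> = (norm (Gv w - full_grad t w))\<^sup>2 + (Gv w \<bullet> full_grad t w) - (3 / 4) * (norm (full_grad t w))\<^sup>2"
      unfolding power2_norm_eq_inner
      by (simp add: inner_add_left inner_add_right inner_diff_left inner_diff_right inner_commute field_simps)
    finally show ?thesis
      using gap[of w] by linarith
  qed
  have "(\<integral>w. f (x_virt (Suc t) w) \<partial>P)
      \<le> (\<integral>w. f (x_virt t w) - ?h * (Gv w \<bullet> g_avg t w) + L / 2 * ?h\<^sup>2 * (norm (g_avg t w))\<^sup>2 \<partial>P)"
  proof (rule integral_mono)
    show "integrable P (\<lambda>w. f (x_virt (Suc t) w))"
      using t by (intro f_x_virt_integrable) simp
    show "integrable P (\<lambda>w. f (x_virt t w) - ?h * (Gv w \<bullet> g_avg t w) + L / 2 * ?h\<^sup>2 * (norm (g_avg t w))\<^sup>2)"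
      using t f_x_virt_integrable[of t] sq_int_inner[OF GvI g_avg_sq_int] sq_int_integrable[OF g_avg_sq_int]
      by simp
    show "f (x_virt (Suc t) w) \<le> f (x_virt t w) - ?h * (Gv w \<bullet> g_avg t w) + L / 2 * ?h\<^sup>2 * (norm (g_avg t w))\<^sup>2" for w
      using lipschitz_grad_descent[OF f_diff f_lip, of "x_virt t w" "- (?h *\<^sub>R g_avg t w)"]
      by (simp add: x_virt_Suc Gv_def power_mult_distrib algebra_simps)
  qed
  also have "\<dots> = (\<integral>w. f (x_virt t w) \<partial>P) - ?h * (\<integral>w. Gv w \<bullet> g_avg t w \<partial>P) + L / 2 * ?h\<^sup>2 * second_moment P (g_avg t)"
    using t f_x_virt_integrable[of t] sq_int_inner[OF GvI g_avg_sq_int] sq_int_integrable[OF g_avg_sq_int]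
    by simp
  also have "(\<integral>w. Gv w \<bullet> g_avg t w \<partial>P) = (\<integral>w. Gv w \<bullet> full_grad t w \<partial>P)"
    by (rule integral_inner_g_avg[OF t GvI GvH])
  finally have main: "(\<integral>w. f (x_virt (Suc t) w) \<partial>P)
      \<le> (\<integral>w. f (x_virt t w) \<partial>P) + ?h * (- (\<integral>w. Gv w \<bullet> full_grad t w \<partial>P)) + L / 2 * ?h\<^sup>2 * second_moment P (g_avg t)"
    by simp
  have "- (\<integral>w. Gv w \<bullet> full_grad t w \<partial>P) = (\<integral>w. - (Gv w \<bullet> full_grad t w) \<partial>P)"
    by simp
  also have "\<dots> \<le> (\<integral>w. - (3 / 4) * (norm (full_grad t w))\<^sup>2 + L\<^sup>2 * (?h'\<^sup>2 * (norm (err t w))\<^sup>2) \<partial>P)"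
    using sq_int_inner[OF GvI gI] sq_int_integrable[OF gI] sq_int_integrable[OF errI]
    by (intro integral_mono cross) auto
  also have "\<dots> = - (3 / 4) * second_moment P (full_grad t) + L\<^sup>2 * (?h'\<^sup>2 * second_moment P (err t))"
    using sq_int_integrable[OF gI] sq_int_integrable[OF errI] by simp
  finally have inner_le: "?h * (- (\<integral>w. Gv w \<bullet> full_grad t w \<partial>P))
      \<le> ?h * (- (3 / 4) * second_moment P (full_grad t) + L\<^sup>2 * (?h'\<^sup>2 * second_moment P (err t)))"
    using h by (intro mult_left_mono) auto
  have sq_le: "L / 2 * ?h\<^sup>2 * second_moment P (g_avg t) \<le> L / 2 * ?h\<^sup>2 * (second_moment P (full_grad t) + \<sigma>\<^sup>2 / real M)"
    using L_nonneg by (intro mult_left_mono g_avg_second_moment t) auto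
  note order_trans[OF main add_mono[OF add_mono[OF order_refl inner_le] sq_le]]
  also have "(\<integral>w. f (x_virt t w) \<partial>P)
      + ?h * (- (3 / 4) * second_moment P (full_grad t) + L\<^sup>2 * (?h'\<^sup>2 * second_moment P (err t)))
      + L / 2 * ?h\<^sup>2 * (second_moment P (full_grad t) + \<sigma>\<^sup>2 / real M)
    = (\<integral>w. f (x_virt t w) \<partial>P) - ?h * (3 - 2 * L * ?h) / 4 * second_moment P (full_grad t)
      + ?h * L\<^sup>2 * (?h'\<^sup>2 * second_moment P (err t)) + L * ?h\<^sup>2 * \<sigma>\<^sup>2 / (2 * real M)"
    using workers by (simp add: field_simps power2_eq_square)
  finally show ?thesis .
qed

lemma weighted_gradient_sum_bound:
  "(\<Sum>t<T. \<eta> (int t) * (3 - 2 * L * \<eta> (int t)) * second_moment P (full_grad t))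
    \<le> 4 * (f x0 - fmin) + 2 * L * \<sigma>\<^sup>2 / real M * (\<Sum>t<T. (\<eta> (int t))\<^sup>2)
      + 8 * (1 - \<delta>) * L\<^sup>2 * worker_const * (\<Sum>t<T. \<eta> (int t) * worker_sum t)
      + 8 * (1 - \<delta>) * L\<^sup>2 * server_const * (\<Sum>t<T. \<eta> (int t) * server_sum t)"
proof -
  interpret prob_space P by (rule prob_P)
  let ?F = "\<lambda>t. \<integral>w. f (x_virt t w) \<partial>P"
  have "\<eta> (int t) * (3 - 2 * L * \<eta> (int t)) * second_moment P (full_grad t)
      \<le> 4 * (?F t - ?F (Suc t)) + 2 * L * \<sigma>\<^sup>2 / real M * (\<eta> (int t))\<^sup>2
      + 8 * (1 - \<delta>) * L\<^sup>2 * worker_const * (\<eta> (int t) * worker_sum t) + 8 * (1 - \<delta>) * L\<^sup>2 * server_const * (\<eta> (int t) * server_sum t)"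
    if t: "t < T" for t
  proof -
    have "\<eta> (int t) * L\<^sup>2 * ((\<eta> (int t - 1))\<^sup>2 * second_moment P (err t))
        \<le> \<eta> (int t) * L\<^sup>2 * (2 * (1 - \<delta>) * (worker_const * worker_sum t + server_const * server_sum t))"
      using t rate_pos[of t] by (intro mult_left_mono err_bound) auto
    with virtual_descent[OF t]
    have "?F (Suc t) \<le> ?F t - \<eta> (int t) * (3 - 2 * L * \<eta> (int t)) / 4 * second_moment P (full_grad t)
      + \<eta> (int t) * L\<^sup>2 * (2 * (1 - \<delta>) * (worker_const * worker_sum t + server_const * server_sum t)) + L * (\<eta> (int t))\<^sup>2 * \<sigma>\<^sup>2 / (2 * real M)"
      by linarith
    then have "4 * ?F (Suc t) \<le> 4 * (?F t - \<eta> (int t) * (3 - 2 * L * \<eta> (int t)) / 4 * second_moment P (full_grad t)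
      + \<eta> (int t) * L\<^sup>2 * (2 * (1 - \<delta>) * (worker_const * worker_sum t + server_const * server_sum t)) + L * (\<eta> (int t))\<^sup>2 * \<sigma>\<^sup>2 / (2 * real M))"
      by (intro mult_left_mono) auto
    also have "4 * (F - A / 4 * N + h * L\<^sup>2 * (2 * (1 - \<delta>) * (worker_const * v + server_const * u)) + L * h\<^sup>2 * \<sigma>\<^sup>2 / (2 * real M))
        = 4 * F - A * N + 2 * L * \<sigma>\<^sup>2 / real M * h\<^sup>2
          + 8 * (1 - \<delta>) * L\<^sup>2 * worker_const * (h * v) + 8 * (1 - \<delta>) * L\<^sup>2 * server_const * (h * u)" for F A N h v u
      by (simp add: algebra_simps)
    finally show ?thesis
      by (simp add: right_diff_distrib)
  qed
  then have "(\<Sum>t<T. \<eta> (int t) * (3 - 2 * L * \<eta> (int t)) * second_moment P (full_grad t))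
    \<le> (\<Sum>t<T. 4 * (?F t - ?F (Suc t)) + 2 * L * \<sigma>\<^sup>2 / real M * (\<eta> (int t))\<^sup>2
      + 8 * (1 - \<delta>) * L\<^sup>2 * worker_const * (\<eta> (int t) * worker_sum t) + 8 * (1 - \<delta>) * L\<^sup>2 * server_const * (\<eta> (int t) * server_sum t))"
    by (intro sum_mono) auto
  also have "\<dots> = 4 * (?F 0 - ?F T) + 2 * L * \<sigma>\<^sup>2 / real M * (\<Sum>t<T. (\<eta> (int t))\<^sup>2)
      + 8 * (1 - \<delta>) * L\<^sup>2 * worker_const * (\<Sum>t<T. \<eta> (int t) * worker_sum t)
      + 8 * (1 - \<delta>) * L\<^sup>2 * server_const * (\<Sum>t<T. \<eta> (int t) * server_sum t)"
    by (simp only: sum.distrib sum_distrib_left[symmetric] sum_lessThan_telescope'[of ?F])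
  also have "?F 0 = f x0"
    by (simp add: x_virt_0 prob_space)
  also have "4 * (f x0 - ?F T) \<le> 4 * (f x0 - fmin)"
  proof -
    have "(\<integral>w. fmin \<partial>P) \<le> ?F T"
      by (intro integral_mono f_x_virt_integrable f_lower) auto
    then show ?thesis by (simp add: prob_space)
  qed
  finally show ?thesis by simp
qed

text \<open>The stated rate writes the sums relative to the previous learning rate, which vanishes in the
  first round; there both inner sums are empty and the default value of division is harmless.\<close>

lemma worker_sum_rescaled:
  "(\<eta> (int t - 1))\<^sup>2 * (\<Sum>k<t. (\<eta> (int t - 1 - int k))\<^sup>2 / (\<eta> (int t - 1))\<^sup>2 * (1 - \<delta> / 2) ^ k) = worker_sum t"
proof (cases t)
  case (Suc s)
  have "(\<eta> (int t - 1))\<^sup>2 \<noteq> 0"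
    using rate_pos[of s] Suc by simp
  moreover have "\<eta> (int t - 1 - int k) = \<eta> (int (t - 1 - k))" if "k < t" for k
    using that by (intro arg_cong[where f = \<eta>]) simp
  ultimately show ?thesis
    unfolding worker_sum_def decayed_sum_reverse sum_distrib_left
    by (intro sum.cong refl) (simp del: of_nat_diff)
qed (simp add: worker_sum_def)

lemma server_sum_rescaled:
  "(\<eta> (int t - 1))\<^sup>2 * (\<Sum>j<t. (1 - \<delta> / 2) ^ (t - 1 - j) *
     (\<Sum>k\<le>j. (\<eta> (int j - int k))\<^sup>2 / (\<eta> (int t - 1))\<^sup>2 * (1 - \<delta> / 2) ^ k)) = server_sum t"
proof (cases t)
  case (Suc s)
  then have nz: "(\<eta> (int t - 1))\<^sup>2 \<noteq> 0"
    using rate_pos[of s] by simp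
  have worker_sum: "worker_sum (Suc j) = (\<eta> (int t - 1))\<^sup>2 *
      (\<Sum>k\<le>j. (\<eta> (int j - int k))\<^sup>2 / (\<eta> (int t - 1))\<^sup>2 * (1 - \<delta> / 2) ^ k)" for j
    unfolding worker_sum_def decayed_sum_reverse sum_distrib_left lessThan_Suc_atMost
    using nz by (intro sum.cong refl) (simp add: of_nat_diff)
  show ?thesis
    unfolding server_sum_def decayed_sum_def worker_sum sum_distrib_left[of "(\<eta> (int t - 1))\<^sup>2" _ "{..<t}"]
    by (intro sum.cong refl) (simp only: mult.left_commute)
qed (simp add: server_sum_def)

end

theorem theorem1:
  fixes P :: "'w measure" and D :: "'d measure" and R :: "'r measure"
    and loss :: "'a::euclidean_space \<Rightarrow> 'd \<Rightarrow> real"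
    and C :: "'r \<Rightarrow> 'a \<Rightarrow> 'a"
    and \<xi> :: "nat \<Rightarrow> nat \<Rightarrow> 'w \<Rightarrow> 'd"
    and \<rho> :: "nat \<Rightarrow> nat \<Rightarrow> 'w \<Rightarrow> 'r" and \<rho>S :: "nat \<Rightarrow> 'w \<Rightarrow> 'r"
    and \<eta> :: "int \<Rightarrow> real" and x0 :: 'a
    and M T :: nat and out :: "nat pmf"
    and \<delta> L \<sigma> \<omega> G :: real
  defines "f \<equiv> risk D loss"
    and "x \<equiv> (\<lambda>t w. model (dist_ef_sgd loss C \<eta> M x0
              (\<lambda>s i. \<xi> s i w) (\<lambda>s i. \<rho> s i w) (\<lambda>s. \<rho>S s w) t))"
  defines "g \<equiv> (\<lambda>t i w. grad (\<lambda>y. loss y (\<xi> t i w)) (x t w))"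
  defines "F \<equiv> (\<lambda>t. history P D R M \<xi> \<rho> \<rho>S t t t)"
  defines "S \<equiv> (\<Sum>k<T. \<eta> (int k) * (3 - 2 * L * \<eta> (int k)))"
  defines "\<alpha> \<equiv> 1 - \<delta> / 2"
  assumes workers: "M \<ge> 1"
    and loss_fun: "loss_function D loss"
    and comp: "compressor R C \<delta>"
    and sampling: "sampling P D R M T \<xi> \<rho> \<rho>S"
    and smooth: "\<forall>y. f differentiable (at y)" "L-lipschitz_on UNIV (grad f)"
    and lower_bounded: "bdd_below (range f)"
    and unbiased: "\<forall>t<T. \<forall>i<M. AE w in P. cond_exp_vec P (F t) (g t i) w = grad f (x t w)"
    and variance: "\<forall>t<T. \<forall>i<M. AE w in P.
        nn_cond_exp P (F t) (\<lambda>v. ennreal ((norm (g t i v - grad f (x t v)))\<^sup>2)) w \<le> ennreal (\<sigma>\<^sup>2)"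
    and bounded_gradient: "\<forall>t<T. AE w in P. (norm (grad f (x t w)))\<^sup>2 \<le> \<omega>\<^sup>2"
    and G: "G\<^sup>2 = \<sigma>\<^sup>2 + \<omega>\<^sup>2"
    and rate_init: "\<eta> (-1) = 0"
    and rates: "\<forall>t::nat. 0 < \<eta> (int t) \<and> (L = 0 \<or> \<eta> (int t) < 3 / (2 * L))"
    and out_range: "set_pmf out \<subseteq> {..<T}"
    and out_prob: "\<forall>k<T. pmf out k = \<eta> (int k) * (3 - 2 * L * \<eta> (int k)) / S"
  shows "(\<Sum>k<T. pmf out k * (\<integral>w. (norm (grad f (x k w)))\<^sup>2 \<partial>P)) \<le>
      4 * (f x0 - (INF y. f y)) / S
    + 2 * L * \<sigma>\<^sup>2 / real M * (\<Sum>t<T. (\<eta> (int t))\<^sup>2 / S)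
    + 8 * (1 - \<delta>) * (2 - \<delta>) * G\<^sup>2 * L\<^sup>2 / (\<delta> * S) *
        (\<Sum>t<T. \<eta> (int t) * (\<eta> (int t - 1))\<^sup>2 *
          (\<Sum>k<t. (\<eta> (int t - 1 - int k))\<^sup>2 / (\<eta> (int t - 1))\<^sup>2 * \<alpha> ^ k))
    + 16 * (1 - \<delta>) * (2 - \<delta>) ^ 3 * G\<^sup>2 * L\<^sup>2 / (\<delta>\<^sup>2 * S) *
        (\<Sum>t<T. \<eta> (int t) * (\<eta> (int t - 1))\<^sup>2 *
          (\<Sum>j<t. \<alpha> ^ (t - 1 - j) *
            (\<Sum>k\<le>j. (\<eta> (int j - int k))\<^sup>2 / (\<eta> (int t - 1))\<^sup>2 * \<alpha> ^ k)))"
proof -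
  interpret run: dist_ef_run P D R loss C \<xi> \<rho> \<rho>S \<eta> x0 M T \<delta>
    using workers loss_fun comp sampling rate_init rates by unfold_locales auto
  have x: "x = run.x"
    by (simp add: x_def run.x_def run.state_def fun_eq_iff)
  have g: "g = run.g"
    by (simp add: g_def run.g_def x fun_eq_iff)
  interpret run: dist_ef_run_smooth P D R loss C \<xi> \<rho> \<rho>S \<eta> x0 M T \<delta> f L \<sigma> \<omega> "INF y. f y"
  proof unfold_locales
    show "(INF y. f y) \<le> f z" for z
      using lower_bounded by (rule cINF_lower) simp
  qed (use smooth unbiased variance bounded_gradient in \<open>auto simp: x g F_def\<close>)
  have L: "0 \<le> L"
    by (rule run.L_nonneg)
  have term_pos: "0 < \<eta> (int k) * (3 - 2 * L * \<eta> (int k))" for k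
  proof -
    have k: "0 < \<eta> (int k)" "L = 0 \<or> \<eta> (int k) < 3 / (2 * L)"
      using rates by auto
    have "2 * L * \<eta> (int k) < 3"
      using k L by (cases "L = 0") (auto simp: field_simps)
    then show ?thesis
      using k(1) by simp
  qed
  have "T \<noteq> 0"
    using out_range set_pmf_not_empty[of out] by auto
  then have S: "0 < S"
    unfolding S_def using term_pos by (intro sum_pos) auto
  let ?b1 = "4 * (f x0 - (INF y. f y))" and ?b2 = "2 * L * \<sigma>\<^sup>2 / real M * (\<Sum>t<T. (\<eta> (int t))\<^sup>2)"
  let ?b3 = "8 * (1 - \<delta>) * L\<^sup>2 * run.worker_const * (\<Sum>t<T. \<eta> (int t) * run.worker_sum t)"
    and ?b4 = "8 * (1 - \<delta>) * L\<^sup>2 * run.server_const * (\<Sum>t<T. \<eta> (int t) * run.server_sum t)"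
  have "(\<Sum>k<T. pmf out k * (\<integral>w. (norm (grad f (x k w)))\<^sup>2 \<partial>P))
      = (\<Sum>k<T. \<eta> (int k) * (3 - 2 * L * \<eta> (int k)) * second_moment P (run.full_grad k)) / S"
    using out_prob by (auto simp: x run.full_grad_def sum_divide_distrib intro!: sum.cong)
  also have "\<dots> \<le> (?b1 + ?b2 + ?b3 + ?b4) / S"
    using run.weighted_gradient_sum_bound S by (intro divide_right_mono) auto
  also have "\<dots> = ?b1 / S + ?b2 / S + ?b3 / S + ?b4 / S"
    by (simp add: add_divide_distrib)
  also have "?b2 / S = 2 * L * \<sigma>\<^sup>2 / real M * (\<Sum>t<T. (\<eta> (int t))\<^sup>2 / S)"
    by (simp add: sum_divide_distrib[symmetric])
  also have "?b3 / S = 8 * (1 - \<delta>) * (2 - \<delta>) * G\<^sup>2 * L\<^sup>2 / (\<delta> * S) *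
        (\<Sum>t<T. \<eta> (int t) * (\<eta> (int t - 1))\<^sup>2 *
          (\<Sum>k<t. (\<eta> (int t - 1 - int k))\<^sup>2 / (\<eta> (int t - 1))\<^sup>2 * \<alpha> ^ k))"
    unfolding mult.assoc[of "\<eta> (int _)" "(\<eta> (int _ - 1))\<^sup>2"] \<alpha>_def run.worker_sum_rescaled run.worker_const_def G[symmetric]
    by (simp add: mult_ac)
  also have "?b4 / S = 16 * (1 - \<delta>) * (2 - \<delta>) ^ 3 * G\<^sup>2 * L\<^sup>2 / (\<delta>\<^sup>2 * S) *
        (\<Sum>t<T. \<eta> (int t) * (\<eta> (int t - 1))\<^sup>2 *
          (\<Sum>j<t. \<alpha> ^ (t - 1 - j) *
            (\<Sum>k\<le>j. (\<eta> (int j - int k))\<^sup>2 / (\<eta> (int t - 1))\<^sup>2 * \<alpha> ^ k)))"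
    unfolding mult.assoc[of "\<eta> (int _)" "(\<eta> (int _ - 1))\<^sup>2"] \<alpha>_def run.server_sum_rescaled run.server_const_def run.worker_const_def G[symmetric]
    by (simp add: power2_eq_square power3_eq_cube mult_ac) (simp add: algebra_simps)
  finally show ?thesis .
qed

end
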